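(* Let $\dot x = Ax+\sum_{i=1}^mB_iu_i$, $y_i=C_ix$ be an $n$-dimensional, jointly controllable and jointly observable $m$-channel continuous-time linear system whose neighbor graph is weakly connected. Let nonnegative integers $n_1,\dots,n_m$ be given and let $\{\bar A,\bar B_i,\bar C_i;m\}$ be the extended system with $\bar A=\begin{bmatrix}A&0\\0&0\end{bmatrix}$ ($\bar n\times\bar n$, $\bar n=n+\sum_in_i$), $\bar B_i=\begin{bmatrix}B_i&0\\0&E_i\end{bmatrix}$, $\bar C_i=\begin{bmatrix}C_i&0\\0&E_{\mathcal{N}_i}'\end{bmatrix}$, where $E_i$ is the $(\sum_kn_k)\times n_i$ block column matrix with $I_{n_i}$ as its $i$th block and zeros elsewhere, and $E_{\mathbf{s}}=[E_{i_1}\ \cdots\ E_{i_s}]$ for $\mathbf{s}=\{i_1<\dots<i_s\}$. Suppose $$n_i\ \ge\ n-\min_{\mathbf{s}\subset\{1,\dots,m\},\ \lambda\in\sigma(A)}\mathrm{rank}\begin{bmatrix}\lambda I_n-A & B_{\mathbf{s}}\\ C_{\{1,\dots,m\}-\mathbf{s}}&0\end{bmatrix}\quad\text{for all } i.$$ Then $\{\bar A,\bar B_i,\bar C_i;m\}$ has no fixed spectrum if and only if $\mathcal{N}_{\{1,\dots,m\}-\mathbf{s}}\cap\mathbf{s}\neq\emptyset$ for every subset $\mathbf{s}\subset\{1,\dots,m\}$ for which there is some $\lambda\in\sigma(A)$ with $\mathrm{rank}\begin{bmatrix}\lambda I_n-A&B_{\mathbf{s}}\\C_{\{1,\dots,m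\}-\mathbf{s}}&0\end{bmatrix}<n$.
   Context: Jointly controllable: $(A,[B_1\ \cdots\ B_m])$ controllable; jointly observable: $(\mathrm{column}\{C_1,\dots,C_m\},A)$ observable. The neighbor graph is a directed graph on $\{1,\dots,m\}$ with an arc $j\to i$ iff $j$ is a neighbor of $i$; $\mathcal{N}_i$ is the set of neighbors of $i$ including $i$, and $\mathcal{N}_{\mathbf{s}}=\bigcup_{i\in\mathbf{s}}\mathcal{N}_i$. A directed graph is weakly connected if removing self-arcs and replacing arcs by undirected edges yields a connected graph. $B_{\mathbf{s}}=[B_{i_1}\ \cdots\ B_{i_s}]$, $C_{\mathbf{s}}=\mathrm{column}\{C_{i_1},\dots,C_{i_s}\}$ for $\mathbf{s}=\{i_1<\dots<i_s\}$. The fixed spectrum of $\{A,B_i,C_i;m\}$ is the set of eigenvalues of $A+\sum_iB_iF_iC_i$ that do not change as the real matrices $F_i$ range over all values. *)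

theory Defs
  imports "Jordan_Normal_Form.Matrix" "Jordan_Normal_Form.Char_Poly" "Jordan_Normal_Form.DL_Rank"
begin

text \<open>Block concatenation of matrices with dimensions (Jordan_Normal_Form matrices).\<close>

definition hcat :: "'a::zero mat \<Rightarrow> 'a mat \<Rightarrow> 'a mat" where
  "hcat M N = mat (dim_row M) (dim_col M + dim_col N)
     (\<lambda>(i,j). if j < dim_col M then M $$ (i,j) else N $$ (i, j - dim_col M))"

definition vcat :: "'a::zero mat \<Rightarrow> 'a mat \<Rightarrow> 'a mat" where
  "vcat M N = mat (dim_row M + dim_row N) (dim_col M)
     (\<lambda>(i,j). if i < dim_row M then M $$ (i,j) else N $$ (i - dim_row M, j))"

text \<open>[M_{i1} ... M_{is}] for s = {i1 < ... < is}; for s empty an r x 0 matrix.\<close>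
definition hcat_set :: "nat \<Rightarrow> (nat \<Rightarrow> 'a::zero mat) \<Rightarrow> nat set \<Rightarrow> 'a mat" where
  "hcat_set r M s = foldr (\<lambda>i X. hcat (M i) X) (sorted_list_of_set s) (0\<^sub>m r 0)"

text \<open>column{M_{i1},...,M_{is}}; for s empty a 0 x c matrix.\<close>
definition vcat_set :: "nat \<Rightarrow> (nat \<Rightarrow> 'a::zero mat) \<Rightarrow> nat set \<Rightarrow> 'a mat" where
  "vcat_set c M s = foldr (\<lambda>i X. vcat (M i) X) (sorted_list_of_set s) (0\<^sub>m 0 c)"

text \<open>Block diagonal matrix diag(M, N).\<close>
definition bdiag :: "'a::zero mat \<Rightarrow> 'a mat \<Rightarrow> 'a mat" where
  "bdiag M N = four_block_mat M (0\<^sub>m (dim_row M) (dim_col N)) (0\<^sub>m (dim_row N) (dim_col M)) N"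

text \<open>Rank of a matrix over a field (library notion).\<close>
definition mrank :: "'a::field mat \<Rightarrow> nat" where
  "mrank M = vec_space.rank (dim_row M) M"

definition cmat :: "real mat \<Rightarrow> complex mat" where
  "cmat M = map_mat complex_of_real M"

text \<open>Spectrum sigma(A) of a real square matrix: its complex eigenvalues.\<close>
definition spec :: "real mat \<Rightarrow> complex set" where
  "spec A = {lam. eigenvalue (cmat A) lam}"

text \<open>Controllability of (A,B), A n x n, via the Kalman rank condition.\<close>
definition controllable :: "real mat \<Rightarrow> real mat \<Rightarrow> bool" where
  "controllable A B = (mrank (hcat_set (dim_row A) (\<lambda>k. A ^\<^sub>m k * B) {..<dim_row A}) = dim_row A)"

text \<open>Observability of (C,A), A n x n, via the Kalman rank condition.\<close>
definition observable :: "real mat \<Rightarrow> real mat \<Rightarrow> bool" where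
  "observable C A = (mrank (vcat_set (dim_row A) (\<lambda>k. C * A ^\<^sub>m k) {..<dim_row A}) = dim_row A)"

text \<open>Neighbor graph: arc j -> i iff j is a neighbor of i (j in Nb i, Nb i includes i).
  Weakly connected: the underlying undirected graph without self loops is connected.\<close>
definition weakly_connected :: "nat \<Rightarrow> (nat \<Rightarrow> nat set) \<Rightarrow> bool" where
  "weakly_connected m Nb =
     (let E = {(j,i). i < m \<and> j \<in> Nb i \<and> j \<noteq> i}
      in \<forall>i<m. \<forall>j<m. (i,j) \<in> (E \<union> E\<inverse>)\<^sup>*)"

definition Nbset :: "(nat \<Rightarrow> nat set) \<Rightarrow> nat set \<Rightarrow> nat set" where
  "Nbset Nb s = (\<Union>i\<in>s. Nb i)"

text \<open>Fixed spectrum of {A, B_i, C_i; m} (channels indexed 0..m-1).\<close>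
definition fixed_spectrum :: "nat \<Rightarrow> real mat \<Rightarrow> (nat \<Rightarrow> real mat) \<Rightarrow> (nat \<Rightarrow> real mat) \<Rightarrow> complex set" where
  "fixed_spectrum m A B C =
     {lam. \<forall>F. (\<forall>i<m. F i \<in> carrier_mat (dim_col (B i)) (dim_row (C i))) \<longrightarrow>
        eigenvalue (cmat (A + foldr (\<lambda>i X. B i * F i * C i + X) [0..<m] (0\<^sub>m (dim_row A) (dim_row A)))) lam}"

text \<open>Extended system. nn k = n_k; offset of block i is the sum of n_k for k < i;
  total extra dimension is the sum of all n_k.\<close>
definition Emat :: "nat \<Rightarrow> (nat \<Rightarrow> nat) \<Rightarrow> nat \<Rightarrow> real mat" where
  "Emat m nn i = mat (\<Sum>k<m. nn k) (nn i)
     (\<lambda>(r,c). if r = (\<Sum>k<i. nn k) + c then 1 else 0)"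

definition Abar :: "nat \<Rightarrow> nat \<Rightarrow> (nat \<Rightarrow> nat) \<Rightarrow> real mat \<Rightarrow> real mat" where
  "Abar n m nn A = bdiag A (0\<^sub>m (\<Sum>k<m. nn k) (\<Sum>k<m. nn k))"

definition Bbar :: "nat \<Rightarrow> (nat \<Rightarrow> nat) \<Rightarrow> (nat \<Rightarrow> real mat) \<Rightarrow> nat \<Rightarrow> real mat" where
  "Bbar m nn B i = bdiag (B i) (Emat m nn i)"

definition Cbar :: "nat \<Rightarrow> (nat \<Rightarrow> nat) \<Rightarrow> (nat \<Rightarrow> nat set) \<Rightarrow> (nat \<Rightarrow> real mat) \<Rightarrow> nat \<Rightarrow> real mat" where
  "Cbar m nn Nb C i = bdiag (C i) (transpose_mat (hcat_set (\<Sum>k<m. nn k) (Emat m nn) (Nb i)))"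

text \<open>The matrix [lambda I - A, B_s; C_{compl s}, 0] over the complex numbers.\<close>
definition pbh :: "nat \<Rightarrow> real mat \<Rightarrow> (nat \<Rightarrow> real mat) \<Rightarrow> (nat \<Rightarrow> real mat) \<Rightarrow> nat set \<Rightarrow> complex \<Rightarrow> complex mat" where
  "pbh m A B C s lam =
     (let n = dim_row A; Bs = hcat_set n (\<lambda>i. cmat (B i)) s;
          Cs = vcat_set n (\<lambda>i. cmat (C i)) ({..<m} - s)
      in four_block_mat (lam \<cdot>\<^sub>m 1\<^sub>m n - cmat A) Bs Cs (0\<^sub>m (dim_row Cs) (dim_col Bs)))"

end

theory Submission
  imports Defs
begin

text \<open>
  Fix \<open>\<lambda>\<close> and put \<open>N = A - \<lambda> I\<close>. Splitting every \<open>B\<^sub>i F\<^sub>i C\<^sub>i\<close> into its rank-one terms, each with its own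
  real parameter, and letting the parameters become generic one at a time shows that some choice of
  the \<open>F\<^sub>i\<close> makes \<open>N + \<Sum> B\<^sub>i F\<^sub>i C\<^sub>i\<close> nonsingular iff for every \<open>s\<close> there are arbitrary \<open>W\<^sub>i\<close>, \<open>Z\<^sub>i\<close> with
  \<open>N + (\<Sum>i\<in>s. B\<^sub>i W\<^sub>i) + (\<Sum>i\<notin>s. Z\<^sub>i C\<^sub>i)\<close> nonsingular. For one term this is the observation that
  if \<open>X\<close> is singular while \<open>X + b w\<^sup>T\<close> and \<open>X + z c\<^sup>T\<close> are not, then \<open>X + f b c\<^sup>T\<close> is nonsingular for
  all \<open>f \<noteq> 0\<close>.

  The rank \<open>r\<close> of \<open>[\<lambda> I - A, B\<^sub>s; C\<^sub>s\<^sub>', 0]\<close>, where \<open>s'\<close> is the complement of \<open>s\<close>, measures by how much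
  this criterion fails: a further correction \<open>G H\<close> through an inner dimension \<open>n - r\<close> is needed. In the
  extended system \<open>G H\<close> arises as a Schur complement through the extra states of a channel
  \<open>k \<in> s \<inter> \<N>(s')\<close>, for which \<open>n\<^sub>k \<ge> n - r\<close> states suffice. If \<open>s \<inter> \<N>(s')\<close> is empty,
  a factorization of the rank-deficient matrix extends to one of the extended closed loop through
  a dimension smaller than \<open>n + \<Sum> n\<^sub>k\<close>, which is therefore always singular.
\<close>

section \<open>Spans of rank-one updates\<close>

definition outer :: "'a::times vec \<Rightarrow> 'a vec \<Rightarrow> 'a mat" where
  "outer b w = mat (dim_vec b) (dim_vec w) (\<lambda>(i,j). b $ i * w $ j)"

lemma outer_carrier [simp]:
  "b \<in> carrier_vec n \<Longrightarrow> w \<in> carrier_vec k \<Longrightarrow> outer b w \<in> carrier_mat n k"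
  by (auto simp: outer_def)

lemma dim_outer [simp]: "dim_row (outer b w) = dim_vec b" "dim_col (outer b w) = dim_vec w"
  by (auto simp: outer_def)

lemma index_outer [simp]:
  "i < dim_vec b \<Longrightarrow> j < dim_vec w \<Longrightarrow> outer b w $$ (i,j) = b $ i * w $ j"
  by (auto simp: outer_def)

lemma transpose_outer: "transpose_mat (outer (b :: 'a::comm_ring_1 vec) w) = outer w b"
  by (rule eq_matI) (auto simp: mult.commute)

lemma mult_outer:
  assumes "G \<in> carrier_mat a b" "v \<in> carrier_vec b" "w \<in> carrier_vec c"
  shows "G * outer v w = outer (G *\<^sub>v v) (w :: 'a::comm_ring_1 vec)"
  using assms by (intro eq_matI) (auto simp: scalar_prod_def sum_distrib_right mult.assoc)

lemma outer_mult:
  assumes "G \<in> carrier_mat b c" "v \<in> carrier_vec a" "w \<in> carrier_vec b"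
  shows "outer v w * G = outer v (transpose_mat G *\<^sub>v (w :: 'a::comm_ring_1 vec))"
  using assms
  by (intro eq_matI) (auto simp: scalar_prod_def sum_distrib_left mult.assoc intro!: sum.cong)

lemma outer_mult_vec:
  assumes "v \<in> carrier_vec b" "w \<in> carrier_vec c" "x \<in> carrier_vec c"
  shows "outer v w *\<^sub>v x = (w \<bullet> x) \<cdot>\<^sub>v (v :: 'a::comm_ring_1 vec)"
  using assms
  by (intro eq_vecI) (auto simp: scalar_prod_def sum_distrib_left mult_ac intro!: sum.cong)

text \<open>These are the corrections
  \<open>(\<Sum>i\<in>s. B_i W_i) + (\<Sum>i\<notin>s. Z_i C_i)\<close> with free \<open>W_i\<close>
  and \<open>Z_i\<close>, broken into rank-one terms. Recording only which vectors may occur as a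
  left or as a right factor removes channels and block order from the argument.\<close>

inductive_set updates :: "nat \<Rightarrow> 'a::comm_ring_1 vec set \<Rightarrow> 'a vec set \<Rightarrow> 'a mat set"
  for n Bs Cs where
  zero: "0\<^sub>m n n \<in> updates n Bs Cs"
| left: "Y \<in> updates n Bs Cs \<Longrightarrow> b \<in> Bs \<Longrightarrow> b \<in> carrier_vec n \<Longrightarrow> w \<in> carrier_vec n
    \<Longrightarrow> Y + outer b w \<in> updates n Bs Cs"
| right: "Y \<in> updates n Bs Cs \<Longrightarrow> c \<in> Cs \<Longrightarrow> c \<in> carrier_vec n \<Longrightarrow> z \<in> carrier_vec n
    \<Longrightarrow> Y + outer z c \<in> updates n Bs Cs"

lemma updates_carrier: "Y \<in> updates n Bs Cs \<Longrightarrow> Y \<in> carrier_mat n n"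
  by (induction rule: updates.induct) auto

lemma updates_mono:
  "Y \<in> updates n Bs Cs \<Longrightarrow> Bs \<subseteq> Bs' \<Longrightarrow> Cs \<subseteq> Cs' \<Longrightarrow> Y \<in> updates n Bs' Cs'"
  by (induction rule: updates.induct) (auto intro: updates.intros)

lemma updates_add:
  assumes "Y \<in> updates n Bs Cs" "X \<in> updates n Bs Cs"
  shows "X + Y \<in> updates n Bs Cs"
  using assms(1)
proof induction
  case zero
  then show ?case using assms(2) by (simp add: updates_carrier)
next
  case (left Y b w)
  have "X + (Y + outer b w) = (X + Y) + outer b w"
    using left assms(2) by (simp add: updates_carrier assoc_add_mat[of _ n n, symmetric])
  then show ?case using left by (simp add: updates.left)
next
  case (right Y c z)
  have "X + (Y + outer z c) = (X + Y) + outer z c"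
    using right assms(2) by (simp add: updates_carrier assoc_add_mat[of _ n n, symmetric])
  then show ?case using right by (simp add: updates.right)
qed

lemma smult_outer: "a \<cdot>\<^sub>m outer b w = outer b (a \<cdot>\<^sub>v (w :: 'a::comm_ring_1 vec))"
  by (rule eq_matI) auto

lemma smult_outer': "a \<cdot>\<^sub>m outer b w = outer (a \<cdot>\<^sub>v b) (w :: 'a::comm_ring_1 vec)"
  by (rule eq_matI) auto

lemma updates_smult:
  assumes "Y \<in> updates n Bs Cs"
  shows "a \<cdot>\<^sub>m Y \<in> updates n Bs Cs"
  using assms
proof induction
  case zero
  then show ?case by (simp add: updates.zero)
next
  case (left Y b w)
  then show ?case
    by (simp add: updates_carrier add_smult_distrib_left_mat[of _ n n] smult_outer updates.left)
next
  case (right Y c z)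
  then show ?case
    by (simp add: updates_carrier add_smult_distrib_left_mat[of _ n n] smult_outer' updates.right)
qed

lemma updates_transpose:
  assumes "Y \<in> updates n Bs Cs"
  shows "transpose_mat Y \<in> updates n Cs Bs"
  using assms
proof induction
  case zero
  then show ?case by (simp add: updates.zero)
next
  case (left Y b w)
  then show ?case by (simp add: updates_carrier transpose_add[of _ n n] transpose_outer updates.right)
next
  case (right Y c z)
  then show ?case by (simp add: updates_carrier transpose_add[of _ n n] transpose_outer updates.left)
qed

text \<open>All terms with left factor \<open>b\<close> merge into one, since
  \<open>outer b w + outer b w'\<close> is \<open>outer b (w + w')\<close>. This isolates the
  dependence on one chosen vector, as the induction over rank-one terms requires.\<close>

lemma updates_insert_left:
  assumes "Y \<in> updates n (insert b Bs) Cs" and b: "b \<in> carrier_vec n"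
  obtains Y' w where "Y' \<in> updates n Bs Cs" "w \<in> carrier_vec n" "Y = Y' + outer b w"
proof -
  have "\<exists>Y'\<in>updates n Bs Cs. \<exists>w\<in>carrier_vec n. Y = Y' + outer b w"
    using assms(1)
  proof induction
    case zero
    have "0\<^sub>m n n = 0\<^sub>m n n + outer b (0\<^sub>v n)" using b by (intro eq_matI) auto
    then show ?case using updates.zero by (metis zero_carrier_vec)
  next
    case (left Y b' w')
    then obtain Y' w where Y: "Y' \<in> updates n Bs Cs" "w \<in> carrier_vec n" "Y = Y' + outer b w"
      by blast
    show ?case
    proof (cases "b' = b")
      case True
      have "Y + outer b' w' = Y' + outer b (w + w')"
        unfolding Y(3) True using updates_carrier[OF Y(1)] Y(2) left(4) b
        by (intro eq_matI) (auto simp: algebra_simps)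
      then show ?thesis using Y left(4) by (metis add_carrier_vec)
    next
      case False
      have "Y + outer b' w' = (Y' + outer b' w') + outer b w"
        unfolding Y(3) using updates_carrier[OF Y(1)] Y(2) left(3,4) b
        by (intro eq_matI) (auto simp: algebra_simps)
      then show ?thesis using Y left False by (metis insertE updates.left)
    qed
  next
    case (right Y c z)
    then obtain Y' w where Y: "Y' \<in> updates n Bs Cs" "w \<in> carrier_vec n" "Y = Y' + outer b w"
      by blast
    have "Y + outer z c = (Y' + outer z c) + outer b w"
      unfolding Y(3) using updates_carrier[OF Y(1)] Y(2) right(3,4) b
      by (intro eq_matI) (auto simp: algebra_simps)
    then show ?case using Y right by (metis updates.right)
  qed
  then show thesis using that by blast
qed

lemma updates_insert_right:
  assumes "Y \<in> updates n Bs (insert c Cs)" and c: "c \<in> carrier_vec n"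
  obtains Y' z where "Y' \<in> updates n Bs Cs" "z \<in> carrier_vec n" "Y = Y' + outer z c"
proof -
  from updates_insert_left[OF updates_transpose[OF assms(1)] c]
  obtain Y' w where Y: "Y' \<in> updates n Cs Bs" "w \<in> carrier_vec n"
    "transpose_mat Y = Y' + outer c w" by metis
  have "Y = transpose_mat (Y' + outer c w)" using Y(3) by (metis transpose_transpose)
  also have "\<dots> = transpose_mat Y' + outer w c"
    using Y(1,2) c by (simp add: updates_carrier transpose_add[of _ n n] transpose_outer)
  finally show thesis using that Y(2) updates_transpose[OF Y(1)] by blast
qed

text \<open>A matrix product is the sum over \<open>t\<close> of
  \<open>outer (col X t) (row W t)\<close>, and the partial sums over \<open>t < l\<close> are
  handled by induction on \<open>l\<close>.\<close>

lemma updates_mult_left: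
  assumes X: "X \<in> carrier_mat n k" and W: "W \<in> carrier_mat k n" and sub: "set (cols X) \<subseteq> Bs"
  shows "X * W \<in> updates n Bs Cs"
proof -
  have part: "mat n n (\<lambda>(i,j). \<Sum>t<l. X $$ (i,t) * W $$ (t,j)) \<in> updates n Bs Cs" if "l \<le> k" for l
    using that
  proof (induction l)
    case 0
    have "mat n n (\<lambda>(i,j). \<Sum>t<0. X $$ (i,t) * W $$ (t,j)) = 0\<^sub>m n n" by (rule eq_matI) auto
    then show ?case by (metis updates.zero)
  next
    case (Suc l)
    have "mat n n (\<lambda>(i,j). \<Sum>t<Suc l. X $$ (i,t) * W $$ (t,j)) =
        mat n n (\<lambda>(i,j). \<Sum>t<l. X $$ (i,t) * W $$ (t,j)) + outer (col X l) (row W l)"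
      using Suc.prems X W by (intro eq_matI) auto
    moreover have "col X l \<in> Bs" using sub Suc.prems X by (auto simp: cols_def)
    moreover have "col X l \<in> carrier_vec n" "row W l \<in> carrier_vec n" using X W by auto
    moreover have "mat n n (\<lambda>(i,j). \<Sum>t<l. X $$ (i,t) * W $$ (t,j)) \<in> updates n Bs Cs"
      using Suc by simp
    ultimately show ?case by (simp only: updates.left)
  qed
  have "X * W = mat n n (\<lambda>(i,j). \<Sum>t<k. X $$ (i,t) * W $$ (t,j))"
    using X W by (intro eq_matI) (auto simp: scalar_prod_def atLeast0LessThan)
  then show ?thesis using part[of k] by simp
qed

lemma updates_mult_right:
  assumes Z: "Z \<in> carrier_mat n k" and X: "X \<in> carrier_mat k n" and sub: "set (rows X) \<subseteq> Cs"
  shows "Z * X \<in> updates n Bs Cs"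
proof -
  have "transpose_mat X * transpose_mat Z \<in> updates n Cs Bs"
    using assms by (intro updates_mult_left[of _ _ k]) auto
  then have "transpose_mat (transpose_mat X * transpose_mat Z) \<in> updates n Bs Cs"
    by (rule updates_transpose)
  moreover have "transpose_mat (transpose_mat X * transpose_mat Z) = Z * X"
    using assms by (simp add: transpose_mult[of _ n k])
  ultimately show ?thesis by simp
qed

section \<open>Generic nonsingularity of rank-one updates\<close>

lemma det_nonzero_iff_kernel:
  fixes X :: "'a::field mat"
  assumes "X \<in> carrier_mat n n"
  shows "det X \<noteq> 0 \<longleftrightarrow> (\<forall>v\<in>carrier_vec n. X *\<^sub>v v = 0\<^sub>v n \<longrightarrow> v = 0\<^sub>v n)"
  using det_0_iff_vec_prod_zero_field[OF assms] by blast

lemma zero_smult_vec [simp]: "v \<in> carrier_vec n \<Longrightarrow> 0 \<cdot>\<^sub>v v = 0\<^sub>v n"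
  for v :: "'a::comm_ring_1 vec"
  by (intro eq_vecI) auto

text \<open>The determinant along the line is a polynomial in \<open>t\<close>, namely the
  determinant of a matrix with linear polynomial entries. Being nonzero at \<open>t0\<close>, it has
  finitely many roots.\<close>

lemma finite_zeros_det_line:
  fixes X Y :: "'a::field mat"
  assumes X: "X \<in> carrier_mat n n" and Y: "Y \<in> carrier_mat n n"
    and nz: "det (X + t0 \<cdot>\<^sub>m Y) \<noteq> 0"
  shows "finite {t. det (X + t \<cdot>\<^sub>m Y) = 0}"
proof -
  define P where "P = mat n n (\<lambda>(i,j). [:X $$ (i,j), Y $$ (i,j):])"
  have eval: "poly (det P) t = det (X + t \<cdot>\<^sub>m Y)" for t
  proof -
    have "poly (det P) t = det (map_mat (\<lambda>p. poly p t) P)"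
      by (rule comm_ring_hom.hom_det[symmetric]) (unfold_locales, auto)
    also have "map_mat (\<lambda>p. poly p t) P = X + t \<cdot>\<^sub>m Y"
      using X Y by (intro eq_matI) (auto simp: P_def)
    finally show ?thesis .
  qed
  have "det P \<noteq> 0" using nz eval[of t0] by auto
  then show ?thesis using poly_roots_finite[of "det P"] by (simp add: eval)
qed

lemma finite_zeros_det_real_line:
  fixes X Y :: "complex mat"
  assumes "X \<in> carrier_mat n n" "Y \<in> carrier_mat n n" "det (X + t0 \<cdot>\<^sub>m Y) \<noteq> 0"
  shows "finite {t::real. det (X + complex_of_real t \<cdot>\<^sub>m Y) = 0}"
proof -
  have "finite (complex_of_real -` {t. det (X + t \<cdot>\<^sub>m Y) = 0})"
    by (rule finite_vimageI[OF finite_zeros_det_line[OF assms]]) (simp add: inj_on_def)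
  then show ?thesis by (simp add: vimage_def)
qed

text \<open>Each of the two determinants excludes only finitely many parameters, so a common good
  one exists even though \<open>t0\<close> and \<open>t1\<close> may differ.\<close>

lemma ex_det_line_nonzero2:
  fixes X Y X' Y' :: "'a::{field_char_0} mat"
  assumes "X \<in> carrier_mat n n" "Y \<in> carrier_mat n n" "det (X + t0 \<cdot>\<^sub>m Y) \<noteq> 0"
    and "X' \<in> carrier_mat k k" "Y' \<in> carrier_mat k k" "det (X' + t1 \<cdot>\<^sub>m Y') \<noteq> 0"
  shows "\<exists>t. det (X + t \<cdot>\<^sub>m Y) \<noteq> 0 \<and> det (X' + t \<cdot>\<^sub>m Y') \<noteq> 0"
proof -
  have "finite ({t. det (X + t \<cdot>\<^sub>m Y) = 0} \<union> {t. det (X' + t \<cdot>\<^sub>m Y') = 0})"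
    using finite_zeros_det_line assms by blast
  then show ?thesis using ex_new_if_finite[OF infinite_UNIV_char_0] by blast
qed

text \<open>A left null vector \<open>u\<close> of \<open>X\<close> has
  \<open>b \<bullet> u \<noteq> 0\<close>, since otherwise it would annihilate
  \<open>X + outer b w\<close> as well. Pairing \<open>u\<close> with a kernel equation for
  \<open>v\<close> therefore forces \<open>c \<bullet> v = 0\<close> and then
  \<open>X *\<^sub>v v = 0\<close>, so \<open>v\<close> is in the kernel of
  \<open>X + outer z c\<close> and vanishes.\<close>

lemma det_rank1_update_nonzero:
  fixes X :: "'a::field mat"
  assumes X: "X \<in> carrier_mat n n" and b: "b \<in> carrier_vec n" and c: "c \<in> carrier_vec n"
    and w: "w \<in> carrier_vec n" and z: "z \<in> carrier_vec n"
    and sing: "det X = 0" and bw: "det (X + outer b w) \<noteq> 0" and zc: "det (X + outer z c) \<noteq> 0"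
    and f: "f \<noteq> 0"
  shows "det (X + f \<cdot>\<^sub>m outer b c) \<noteq> 0"
proof -
  have "det (transpose_mat X) = 0" using sing det_transpose[OF X] by simp
  then obtain u where u: "u \<in> carrier_vec n" "u \<noteq> 0\<^sub>v n" "transpose_mat X *\<^sub>v u = 0\<^sub>v n"
    using X det_0_iff_vec_prod_zero_field[of "transpose_mat X" n] by auto
  have ub: "b \<bullet> u \<noteq> 0"
  proof
    assume "b \<bullet> u = 0"
    then have "transpose_mat (X + outer b w) *\<^sub>v u = 0\<^sub>v n"
      using X b w u by (simp add: transpose_add[of _ n n] transpose_outer
          add_mult_distrib_mat_vec[of _ n n] outer_mult_vec)
    moreover have "det (transpose_mat (X + outer b w)) \<noteq> 0"
      using bw det_transpose[of "X + outer b w" n] X b w by simp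
    ultimately show False
      using det_nonzero_iff_kernel[of "transpose_mat (X + outer b w)" n] X b w u by simp
  qed
  have "v = 0\<^sub>v n" if v: "v \<in> carrier_vec n" and eq: "(X + f \<cdot>\<^sub>m outer b c) *\<^sub>v v = 0\<^sub>v n" for v
  proof -
    have eq': "X *\<^sub>v v + (f * (c \<bullet> v)) \<cdot>\<^sub>v b = 0\<^sub>v n"
      using eq X b c v by (simp add: add_mult_distrib_mat_vec[of _ n n] smult_outer' outer_mult_vec
          mult.commute smult_smult_assoc)
    have "u \<bullet> (X *\<^sub>v v) = (transpose_mat X *\<^sub>v u) \<bullet> v"
      using transpose_vec_mult_scalar[of X n n v u] X u v by simp
    also have "\<dots> = 0" using u v by simp
    finally have "u \<bullet> (X *\<^sub>v v) = 0" .
    moreover have "u \<bullet> (X *\<^sub>v v + (f * (c \<bullet> v)) \<cdot>\<^sub>v b) = 0" using eq' u by simp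
    ultimately have "(f * (c \<bullet> v)) * (u \<bullet> b) = 0"
      using X u v b by (simp add: scalar_prod_add_distrib[of _ n])
    moreover have "u \<bullet> b \<noteq> 0" using ub u b by (simp add: comm_scalar_prod[of _ n])
    ultimately have cv: "c \<bullet> v = 0" using f by simp
    have Xv: "X *\<^sub>v v = 0\<^sub>v n" using eq' cv X v b by auto
    have "(X + outer z c) *\<^sub>v v = 0\<^sub>v n"
      using Xv cv X z c v by (simp add: add_mult_distrib_mat_vec[of _ n n] outer_mult_vec)
    then show ?thesis using zc det_nonzero_iff_kernel[of "X + outer z c" n] X z c v by simp
  qed
  then show ?thesis using det_nonzero_iff_kernel[of "X + f \<cdot>\<^sub>m outer b c" n] X b c by simp
qed

text \<open>If \<open>X\<close> is singular, only \<open>f = 0\<close> can be a root. If it is not,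
  the line in \<open>f\<close> starts at a nonsingular matrix.\<close>

lemma finite_zeros_det_rank1_update:
  fixes X :: "complex mat"
  assumes "X \<in> carrier_mat n n" "b \<in> carrier_vec n" "c \<in> carrier_vec n"
    "w \<in> carrier_vec n" "z \<in> carrier_vec n"
    "det (X + outer b w) \<noteq> 0" "det (X + outer z c) \<noteq> 0"
  shows "finite {f::real. det (X + complex_of_real f \<cdot>\<^sub>m outer b c) = 0}"
proof (cases "det X = 0")
  case True
  then have "{f::real. det (X + complex_of_real f \<cdot>\<^sub>m outer b c) = 0} \<subseteq> {0}"
    using det_rank1_update_nonzero[OF assms(1-5) _ assms(6,7)] by fastforce
  then show ?thesis using finite_subset by blast
next
  case False
  moreover have "X + 0 \<cdot>\<^sub>m outer b c = X" using assms by (intro eq_matI) auto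
  ultimately show ?thesis
    using finite_zeros_det_real_line[of X n "outer b c" 0] assms by simp
qed

text \<open>These are the corrections reachable by actual gains: both factors of each term are fixed
  and only a real coefficient varies, whereas \<open>updates\<close> leaves one factor free. A
  repeated index adds to its coefficient.\<close>

inductive_set real_updates :: "('j \<Rightarrow> complex vec) \<Rightarrow> ('j \<Rightarrow> complex vec) \<Rightarrow> nat \<Rightarrow> 'j set \<Rightarrow> complex mat set"
  for b c n T where
  zero: "0\<^sub>m n n \<in> real_updates b c n T"
| step: "Y \<in> real_updates b c n T \<Longrightarrow> j \<in> T
    \<Longrightarrow> Y + complex_of_real f \<cdot>\<^sub>m outer (b j) (c j) \<in> real_updates b c n T"

lemma real_updates_mono:
  "Y \<in> real_updates b c n T \<Longrightarrow> T \<subseteq> T' \<Longrightarrow> Y \<in> real_updates b c n T'"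
  by (induction rule: real_updates.induct) (auto intro: real_updates.intros)

lemma real_updates_carrier:
  "Y \<in> real_updates b c n T \<Longrightarrow> (\<And>j. j \<in> T \<Longrightarrow> b j \<in> carrier_vec n \<and> c j \<in> carrier_vec n)
    \<Longrightarrow> Y \<in> carrier_mat n n"
  by (induction rule: real_updates.induct) (auto intro: real_updates.intros)

text \<open>For terms in \<open>J\<close> the right factor is freed, for terms in
  \<open>T - J\<close> the left one. In the induction, one real coefficient for the new term must
  preserve the hypothesis for all \<open>J \<subseteq> T\<close> at once; each \<open>J\<close>
  rules out only finitely many values.\<close>

lemma generic_rank1_updates:
  fixes N :: "complex mat"
  assumes "finite T" "N \<in> carrier_mat n n"
    and "\<And>j. j \<in> T \<Longrightarrow> b j \<in> carrier_vec n \<and> c j \<in> carrier_vec n"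
    and "\<And>J. J \<subseteq> T \<Longrightarrow> \<exists>Y\<in>updates n (b ` J) (c ` (T - J)). det (N + Y) \<noteq> 0"
  shows "\<exists>Y\<in>real_updates b c n T. det (N + Y) \<noteq> 0"
  using assms
proof (induction T arbitrary: N rule: finite_induct)
  case empty
  from empty(3)[of "{}"] obtain Y where Y: "Y \<in> updates n {} {}" "det (N + Y) \<noteq> 0" by auto
  have "Y = 0\<^sub>m n n" using Y(1) by induction auto
  then show ?case using Y(2) real_updates.zero by blast
next
  case (insert j T)
  let ?U = "\<lambda>J. updates n (b ` J) (c ` (T - J))"
  let ?R = "outer (b j) (c j)"
  note N = insert.prems(1)
  have bc: "b j \<in> carrier_vec n" "c j \<in> carrier_vec n" using insert.prems(2) by auto
  have generic: "finite {f::real. \<forall>Y\<in>?U J. det (N + complex_of_real f \<cdot>\<^sub>m ?R + Y) = 0}"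
    if J: "J \<subseteq> T" for J
  proof -
    have J': "insert j T - insert j J = T - J" "insert j T - J = insert j (T - J)"
      using J insert.hyps by auto
    \<comment> \<open>The new term \<open>j\<close> can be freed on either side. This gives
      \<open>Y1\<close> and \<open>Y2\<close>, whose remainders \<open>Y\<close> and
      \<open>Y'\<close> are unrelated.\<close>
    obtain Y1 where Y1: "Y1 \<in> updates n (insert (b j) (b ` J)) (c ` (T - J))" "det (N + Y1) \<noteq> 0"
      using insert.prems(3)[of "insert j J"] J J'(1) by auto
    obtain Y w where Y: "Y \<in> ?U J" "w \<in> carrier_vec n" "Y1 = Y + outer (b j) w"
      using updates_insert_left[OF Y1(1) bc(1)] by metis
    obtain Y2 where Y2: "Y2 \<in> updates n (b ` J) (insert (c j) (c ` (T - J)))" "det (N + Y2) \<noteq> 0"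
      using insert.prems(3)[of J] J J'(2) by auto
    obtain Y' z where Y': "Y' \<in> ?U J" "z \<in> carrier_vec n" "Y2 = Y' + outer z (c j)"
      using updates_insert_right[OF Y2(1) bc(2)] by metis
    note carr = updates_carrier[OF Y(1)] updates_carrier[OF Y'(1)]
    \<comment> \<open>Direction from \<open>Y\<close> to \<open>Y'\<close>. One determinant is
      nonzero at \<open>t = 0\<close> and the other at \<open>t = 1\<close>, so a generic point
      \<open>Yt\<close> of the line is a common remainder for both, as the rank-one argument
      demands.\<close>
    define D where "D = Y' + (-1) \<cdot>\<^sub>m Y"
    have D: "D \<in> ?U J" "D \<in> carrier_mat n n"
      using Y(1) Y'(1) carr by (auto simp: D_def intro!: updates_add updates_smult)
    have "(N + outer (b j) w + Y) + 0 \<cdot>\<^sub>m D = N + Y1"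
      using N bc Y(2) carr D unfolding Y(3) by (intro eq_matI) auto
    moreover have "(N + outer z (c j) + Y) + 1 \<cdot>\<^sub>m D = N + Y2"
      using N bc Y'(2) carr unfolding Y'(3) D_def by (intro eq_matI) auto
    ultimately obtain t where t: "det ((N + outer (b j) w + Y) + t \<cdot>\<^sub>m D) \<noteq> 0"
      "det ((N + outer z (c j) + Y) + t \<cdot>\<^sub>m D) \<noteq> 0"
      using ex_det_line_nonzero2[of "N + outer (b j) w + Y" n D 0 "N + outer z (c j) + Y" n D 1]
        N bc Y(2) Y'(2) carr D Y1(2) Y2(2) by auto
    define Yt where "Yt = Y + t \<cdot>\<^sub>m D"
    have Yt: "Yt \<in> ?U J" "Yt \<in> carrier_mat n n"
      using Y(1) D by (auto simp: Yt_def intro!: updates_add updates_smult)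
    have "(N + outer (b j) w + Y) + t \<cdot>\<^sub>m D = (N + Yt) + outer (b j) w"
      "(N + outer z (c j) + Y) + t \<cdot>\<^sub>m D = (N + Yt) + outer z (c j)"
      using N bc Y(2) Y'(2) carr D unfolding Yt_def by (auto intro!: eq_matI)
    then have "finite {f::real. det ((N + Yt) + complex_of_real f \<cdot>\<^sub>m ?R) = 0}"
      using finite_zeros_det_rank1_update[of "N + Yt" n "b j" "c j" w z] N bc Y(2) Y'(2) Yt t by simp
    moreover have "(N + Yt) + complex_of_real f \<cdot>\<^sub>m ?R = N + complex_of_real f \<cdot>\<^sub>m ?R + Yt" for f
      using N bc Yt by (intro eq_matI) auto
    ultimately show ?thesis using Yt(1) by (auto elim!: finite_subset[rotated])
  qed
  \<comment> \<open>The bad coefficients for \<open>J\<close>. Their union over the finitely many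
    subsets of \<open>T\<close> is finite, so some real \<open>f\<close> avoids them all.\<close>
  define S where "S J = {f::real. \<forall>Y\<in>?U J. det (N + complex_of_real f \<cdot>\<^sub>m ?R + Y) = 0}" for J
  have "finite (\<Union>J\<in>Pow T. S J)" using generic insert.hyps by (auto simp: S_def)
  then have "\<exists>f::real. f \<notin> (\<Union>J\<in>Pow T. S J)"
    by (rule ex_new_if_finite[OF infinite_UNIV_char_0])
  then obtain f :: real where "\<forall>J\<in>Pow T. f \<notin> S J" by auto
  then have f: "\<exists>Y\<in>?U J. det (N + complex_of_real f \<cdot>\<^sub>m ?R + Y) \<noteq> 0" if "J \<subseteq> T" for J
    using that unfolding S_def by simp
  have "\<exists>Y\<in>real_updates b c n T. det ((N + complex_of_real f \<cdot>\<^sub>m ?R) + Y) \<noteq> 0"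
    using N bc insert.prems(2) f by (intro insert.IH) auto
  then obtain Y where Y: "Y \<in> real_updates b c n T" "det ((N + complex_of_real f \<cdot>\<^sub>m ?R) + Y) \<noteq> 0"
    by blast
  have "Y \<in> carrier_mat n n" using real_updates_carrier[OF Y(1)] insert.prems(2) by blast
  then have "(N + complex_of_real f \<cdot>\<^sub>m ?R) + Y = N + (Y + complex_of_real f \<cdot>\<^sub>m ?R)"
    using N bc by (intro eq_matI) auto
  moreover have "Y + complex_of_real f \<cdot>\<^sub>m ?R \<in> real_updates b c n (insert j T)"
    by (rule real_updates.step[OF real_updates_mono[OF Y(1)]]) auto
  ultimately show ?case using Y(2) by metis
qed

section \<open>Factorizations through a smaller inner dimension\<close>

lemma mult_mat_zero_vec: "M \<in> carrier_mat l k \<Longrightarrow> M *\<^sub>v 0\<^sub>v k = 0\<^sub>v l"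
  for M :: "'a::comm_ring_1 mat"
  by (intro eq_vecI) auto

lemma mult_mat_unit_vec:
  fixes M :: "'a::comm_ring_1 mat"
  assumes "M \<in> carrier_mat n k" "j < k"
  shows "M *\<^sub>v unit_vec k j = col M j"
  using assms by (intro eq_vecI) (auto simp: scalar_prod_right_unit[of _ k])

text \<open>\<open>\<Lambda>\<close> has fewer rows than columns and hence kills a nonzero vector.
  Padding it with zero rows to a square matrix yields that vector from a vanishing
  determinant.\<close>

lemma singular_of_factorization:
  fixes \<Gamma> \<Lambda> :: "'a::field mat"
  assumes G: "\<Gamma> \<in> carrier_mat n r" and L: "\<Lambda> \<in> carrier_mat r n" and r: "r < n"
  shows "det (\<Gamma> * \<Lambda>) = 0"
proof -
  define X where "X = mat n n (\<lambda>(i,j). if i < r then \<Lambda> $$ (i,j) else 0)"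
  have X: "X \<in> carrier_mat n n" by (simp add: X_def)
  \<comment> \<open>The unit vector at \<open>n - 1\<close> picks the last row of \<open>X\<close>,
    which is padding because \<open>r < n\<close>.\<close>
  have "transpose_mat X *\<^sub>v unit_vec n (n - 1) = 0\<^sub>v n"
    using r X by (subst mult_mat_unit_vec[of _ n n]) (auto simp: X_def intro!: eq_vecI)
  moreover have "unit_vec n (n - 1) \<noteq> (0\<^sub>v n :: 'a vec)" using r by (simp add: unit_vec_nonzero)
  ultimately have "det (transpose_mat X) = 0"
    using det_nonzero_iff_kernel[of "transpose_mat X" n] X by auto
  then have "det X = 0" using det_transpose[OF X] by simp
  then obtain v where v: "v \<in> carrier_vec n" "v \<noteq> 0\<^sub>v n" "X *\<^sub>v v = 0\<^sub>v n"
    using det_nonzero_iff_kernel[OF X] by blast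
  have "\<Lambda> *\<^sub>v v = 0\<^sub>v r"
  proof (rule eq_vecI)
    fix i assume "i < dim_vec (0\<^sub>v r :: 'a vec)"
    then have i: "i < r" by simp
    then have "row X i = row \<Lambda> i" using L r by (intro eq_vecI) (auto simp: X_def)
    moreover have "(X *\<^sub>v v) $ i = 0" using v(3) i r by simp
    ultimately show "(\<Lambda> *\<^sub>v v) $ i = 0\<^sub>v r $ i" using i r X L by simp
  qed (use L in simp)
  then have "(\<Gamma> * \<Lambda>) *\<^sub>v v = 0\<^sub>v n" using mult_mat_zero_vec[OF G] G L v(1) by (simp add: assoc_mult_mat_vec[of _ n r _ n])
  then show ?thesis using det_nonzero_iff_kernel[of "\<Gamma> * \<Lambda>" n] G L v by auto
qed

text \<open>A term \<open>outer b w\<close> with \<open>b = \<Gamma> *\<^sub>v v\<close> is absorbed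
  by adding \<open>outer v w\<close> to \<open>\<Lambda>\<close>, and dually for
  \<open>outer z c\<close>. Because \<open>u \<bullet> v = 0\<close>, this leaves the values of the
  transposed \<open>\<Lambda>\<close> on \<open>U\<close> intact. The last two conjuncts are the
  invariants that let the next term be absorbed in the same inner dimension
  \<open>r\<close>.\<close>

lemma updates_factorization:
  fixes N :: "'a::field mat"
  assumes N: "N = U1 * V1" "U1 \<in> carrier_mat n r" "V1 \<in> carrier_mat r n"
    and V: "V \<subseteq> carrier_vec r" and U: "U \<subseteq> carrier_vec r"
    and Bs: "Bs \<subseteq> (\<lambda>v. U1 *\<^sub>v v) ` V" and Cs: "Cs \<subseteq> (\<lambda>u. transpose_mat V1 *\<^sub>v u) ` U"
    and orth: "\<And>u v. u \<in> U \<Longrightarrow> v \<in> V \<Longrightarrow> u \<bullet> v = 0"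
    and Y: "Y \<in> updates n Bs Cs"
  shows "\<exists>\<Gamma>\<in>carrier_mat n r. \<exists>\<Lambda>\<in>carrier_mat r n. N + Y = \<Gamma> * \<Lambda>
    \<and> (\<forall>v\<in>V. \<Gamma> *\<^sub>v v = U1 *\<^sub>v v) \<and> (\<forall>u\<in>U. transpose_mat \<Lambda> *\<^sub>v u = transpose_mat V1 *\<^sub>v u)"
  using Y
proof induction
  case zero
  have "N + 0\<^sub>m n n = U1 * V1" using N by simp
  then show ?case using N by blast
next
  case (left Y b w)
  then obtain \<Gamma> \<Lambda> where G: "\<Gamma> \<in> carrier_mat n r" "\<Lambda> \<in> carrier_mat r n" "N + Y = \<Gamma> * \<Lambda>"
    "\<forall>v\<in>V. \<Gamma> *\<^sub>v v = U1 *\<^sub>v v" "\<forall>u\<in>U. transpose_mat \<Lambda> *\<^sub>v u = transpose_mat V1 *\<^sub>v u" by blast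
  obtain v where v: "v \<in> V" "b = U1 *\<^sub>v v" using Bs left(2) by blast
  have vc: "v \<in> carrier_vec r" using V v by blast
  have "N + (Y + outer b w) = (N + Y) + outer b w"
    using N updates_carrier[OF left(1)] left(3,4) by (intro eq_matI) auto
  also have "\<dots> = \<Gamma> * (\<Lambda> + outer v w)"
    using G left(3,4) v vc by (simp add: mult_add_distrib_mat[of _ n r _ n] mult_outer[of _ n r _ _ n])
  finally have "N + (Y + outer b w) = \<Gamma> * (\<Lambda> + outer v w)" .
  moreover have "transpose_mat (\<Lambda> + outer v w) *\<^sub>v u = transpose_mat V1 *\<^sub>v u" if "u \<in> U" for u
  proof -
    have u: "u \<in> carrier_vec r" using U that by blast
    have "v \<bullet> u = 0" using orth[OF that v(1)] comm_scalar_prod[OF u vc] by simp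
    moreover have "0 \<cdot>\<^sub>v w = 0\<^sub>v n" using left(4) by (intro eq_vecI) auto
    ultimately have "transpose_mat (\<Lambda> + outer v w) *\<^sub>v u = transpose_mat \<Lambda> *\<^sub>v u"
      using G u vc left(4) by (simp add: transpose_add[of _ r n] transpose_outer
          add_mult_distrib_mat_vec[of _ n r] outer_mult_vec[of _ n _ r])
    then show ?thesis using G that by simp
  qed
  moreover have "\<Lambda> + outer v w \<in> carrier_mat r n" using G(2) vc left(4) by simp
  ultimately show ?case using G(1,4) by blast
next
  case (right Y c z)
  then obtain \<Gamma> \<Lambda> where G: "\<Gamma> \<in> carrier_mat n r" "\<Lambda> \<in> carrier_mat r n" "N + Y = \<Gamma> * \<Lambda>"
    "\<forall>v\<in>V. \<Gamma> *\<^sub>v v = U1 *\<^sub>v v" "\<forall>u\<in>U. transpose_mat \<Lambda> *\<^sub>v u = transpose_mat V1 *\<^sub>v u" by blast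
  obtain u where u: "u \<in> U" "c = transpose_mat V1 *\<^sub>v u" using Cs right(2) by blast
  have uc: "u \<in> carrier_vec r" using U u by blast
  have "N + (Y + outer z c) = (N + Y) + outer z c"
    using N updates_carrier[OF right(1)] right(3,4) by (intro eq_matI) auto
  also have "\<dots> = (\<Gamma> + outer z u) * \<Lambda>"
    using G right(3,4) u uc by (simp add: add_mult_distrib_mat[of _ n r _ _ n] outer_mult[of _ r n _ n])
  finally have "N + (Y + outer z c) = (\<Gamma> + outer z u) * \<Lambda>" .
  moreover have "(\<Gamma> + outer z u) *\<^sub>v v = U1 *\<^sub>v v" if "v \<in> V" for v
  proof -
    have v: "v \<in> carrier_vec r" using V that by blast
    have "u \<bullet> v = 0" using orth[OF u(1) that] .
    moreover have "0 \<cdot>\<^sub>v z = 0\<^sub>v n" using right(4) by (intro eq_vecI) auto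
    ultimately have "(\<Gamma> + outer z u) *\<^sub>v v = \<Gamma> *\<^sub>v v"
      using G v uc right(4) by (simp add: add_mult_distrib_mat_vec[of _ n r] outer_mult_vec[of _ n _ r])
    then show ?thesis using G that by simp
  qed
  moreover have "\<Gamma> + outer z u \<in> carrier_mat n r" using G(1) uc right(4) by simp
  ultimately show ?case using G(2,5) by blast
qed

lemma updates_singular:
  fixes N :: "'a::field mat"
  assumes "N = U1 * V1" "U1 \<in> carrier_mat n r" "V1 \<in> carrier_mat r n" "r < n"
    and "V \<subseteq> carrier_vec r" "U \<subseteq> carrier_vec r"
    and "Bs \<subseteq> (\<lambda>v. U1 *\<^sub>v v) ` V" "Cs \<subseteq> (\<lambda>u. transpose_mat V1 *\<^sub>v u) ` U"
    and "\<And>u v. u \<in> U \<Longrightarrow> v \<in> V \<Longrightarrow> u \<bullet> v = 0"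
    and "Y \<in> updates n Bs Cs"
  shows "det (N + Y) = 0"
proof -
  obtain \<Gamma> \<Lambda> where "\<Gamma> \<in> carrier_mat n r" "\<Lambda> \<in> carrier_mat r n" "N + Y = \<Gamma> * \<Lambda>"
    using updates_factorization[OF assms(1-3,5-10)] by blast
  then show ?thesis using singular_of_factorization assms(4) by metis
qed

section \<open>Matrix rank and nonsingular updates\<close>

context vec_space
begin

lemma rank_basis_cols:
  assumes M: "M \<in> carrier_mat n nc"
  obtains bs where "distinct bs" "set bs \<subseteq> set (cols M)" "length bs = rank M" "lin_indpt (set bs)"
    "set (cols M) \<subseteq> span (set bs)"
proof -
  obtain S where S: "maximal S (\<lambda>T. T \<subseteq> set (cols M) \<and> lin_indpt T)" "finite S"
    using maximal_exists_superset[of "set (cols M)" "\<lambda>T. T \<subseteq> set (cols M) \<and> lin_indpt T" "{}"]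
      finite_lin_indpt2[of "{}"] by auto
  have sub: "S \<subseteq> set (cols M)" "lin_indpt S" using S(1) by (auto simp: maximal_def)
  have carr: "set (cols M) \<subseteq> carrier_vec n" using M cols_dim by blast
  obtain bs where bs: "set bs = S" "distinct bs" using finite_distinct_list[OF S(2)] by blast
  have "length bs = rank M" using rank_card_indpt[OF M S(1)] bs distinct_card by metis
  moreover have "v \<in> span S" if v: "v \<in> set (cols M)" for v
  proof (rule ccontr)
    assume nv: "v \<notin> span S"
    have "v \<notin> S" using nv span_mem sub(1) carr by auto
    moreover have "lin_indpt (S \<union> {v})"
      using lin_dep_iff_in_span[of S v] sub carr v nv \<open>v \<notin> S\<close> by auto
    ultimately show False using S(1) v sub(1) unfolding maximal_def by blast
  qed
  ultimately show thesis using that[of bs] bs sub by blast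
qed

lemma in_span_imp_mult_mat:
  assumes bs: "distinct bs" "set bs \<subseteq> carrier_vec n" and v: "v \<in> span (set bs)"
  obtains x where "x \<in> carrier_vec (length bs)" "v = mat_of_cols n bs *\<^sub>v x"
proof -
  have "finite (set bs)" by simp
  then obtain a where "v = lincomb a (set bs)" using v finite_span[of "set bs"] bs(2) by auto
  moreover have c: "cols (mat_of_cols n bs) = bs" using bs(2) by (rule cols_mat_of_cols)
  moreover have "mat_of_cols n bs *\<^sub>v vec (length bs) (\<lambda>i. a (col (mat_of_cols n bs) i)) =
      lincomb a (set (cols (mat_of_cols n bs)))"
    by (rule mat_mult_eq_lincomb) (use bs c in auto)
  ultimately show thesis using that by (metis vec_carrier)
qed

text \<open>The left factor consists of a column basis, the right one of the coordinates of all
  columns in it.\<close>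

lemma rank_factorization:
  assumes M: "M \<in> carrier_mat n nc"
  obtains U V where "U \<in> carrier_mat n (rank M)" "V \<in> carrier_mat (rank M) nc" "M = U * V"
proof -
  obtain bs where bs: "distinct bs" "set bs \<subseteq> set (cols M)" "length bs = rank M"
    "set (cols M) \<subseteq> span (set bs)" using rank_basis_cols[OF M] by metis
  have carr: "set bs \<subseteq> carrier_vec n" using bs(2) M cols_dim by blast
  let ?U = "mat_of_cols n bs"
  have "\<exists>x. x \<in> carrier_vec (length bs) \<and> col M j = ?U *\<^sub>v x" if "j < nc" for j
  proof -
    have "col M j \<in> span (set bs)" using bs(4) that M by (auto simp: cols_def)
    then show ?thesis using in_span_imp_mult_mat[OF bs(1) carr] by metis
  qed
  then obtain x where x: "\<And>j. j < nc \<Longrightarrow> x j \<in> carrier_vec (length bs) \<and> col M j = ?U *\<^sub>v x j"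
    by metis
  define V where "V = mat_of_cols (length bs) (map x [0..<nc])"
  have V: "V \<in> carrier_mat (length bs) nc" by (auto simp: V_def)
  have "M = ?U * V"
  proof (rule mat_col_eqI)
    fix j assume "j < dim_col (?U * V)"
    then have j: "j < nc" using V by simp
    have "col V j = x j" unfolding V_def using x j by (subst col_mat_of_cols) auto
    then show "col M j = col (?U * V) j" using x[OF j] j V M
      by (metis col_mult2 mat_of_cols_carrier(1))
  qed (use V M in auto)
  then show thesis using that[of ?U V] V bs(3) mat_of_cols_carrier(1) by metis
qed

text \<open>\<open>Q\<close> selects \<open>k\<close> linearly independent columns of
  \<open>M\<close>.\<close>

lemma rank_ge_injective:
  assumes M: "M \<in> carrier_mat n nc" and k: "k \<le> rank M"
  obtains Q where "Q \<in> carrier_mat nc k"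
    "\<And>v. v \<in> carrier_vec k \<Longrightarrow> (M * Q) *\<^sub>v v = 0\<^sub>v n \<Longrightarrow> v = 0\<^sub>v k"
proof -
  obtain bs where bs: "distinct bs" "set bs \<subseteq> set (cols M)" "length bs = rank M" "lin_indpt (set bs)"
    using rank_basis_cols[OF M] by metis
  have carr: "set bs \<subseteq> carrier_vec n" using bs(2) M cols_dim by blast
  define cs where "cs = take k bs"
  have cs: "distinct cs" "set cs \<subseteq> set bs" "length cs = k"
    using bs k by (auto simp: cs_def dest: in_set_takeD)
  have ind: "lin_indpt (set cs)" using bs(4) cs(2) supset_ld_is_ld by blast
  have "\<exists>j. j < nc \<and> cs ! i = col M j" if "i < k" for i
  proof -
    have "cs ! i \<in> set (cols M)" using that cs bs by (metis nth_mem subsetD)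
    then show ?thesis using M by (auto simp: cols_def)
  qed
  then obtain \<phi> where p: "\<And>i. i < k \<Longrightarrow> \<phi> i < nc \<and> cs ! i = col M (\<phi> i)" by metis
  define Q where "Q = mat nc k (\<lambda>(r,i). if r = \<phi> i then 1 else (0::'a))"
  have Q: "Q \<in> carrier_mat nc k" by (simp add: Q_def)
  have MQ: "M * Q = mat_of_cols n cs"
  proof (rule mat_col_eqI)
    fix i assume "i < dim_col (mat_of_cols n cs)"
    then have i: "i < k" using cs by simp
    have "col Q i = unit_vec nc (\<phi> i)" using i p by (intro eq_vecI) (auto simp: Q_def unit_vec_def)
    then have "col (M * Q) i = col M (\<phi> i)"
      using col_mult2[OF M Q i] mult_mat_unit_vec[OF M, of "\<phi> i"] p[OF i] by simp
    then show "col (M * Q) i = col (mat_of_cols n cs) i"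
      using p[OF i] i cs carr by (metis col_mat_of_cols nth_mem subsetD)
  qed (use M Q cs in auto)
  have c: "cols (mat_of_cols n cs) = cs" using cs carr by (intro cols_mat_of_cols) auto
  have "v = 0\<^sub>v k" if v: "v \<in> carrier_vec k" "(M * Q) *\<^sub>v v = 0\<^sub>v n" for v
  proof (rule ccontr)
    assume "v \<noteq> 0\<^sub>v k"
    then have "lin_dep (set (cols (M * Q)))"
      using v M Q cs(1,3) c MQ mat_of_cols_carrier(1)[of n cs] by (intro lin_depI[of _ k v]) auto
    then show False using ind MQ c by simp
  qed
  then show thesis using that Q by blast
qed

end

section \<open>Nonsingular corrections from a rank bound\<close>

lemma mat_mult_assoc_dim:
  fixes A B C :: "'a::semiring_0 mat"
  shows "dim_col A = dim_row B \<Longrightarrow> dim_col B = dim_row C \<Longrightarrow> A * B * C = A * (B * C)"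
  by (rule assoc_mult_mat[of _ "dim_row A" "dim_col A" _ "dim_col B" _ "dim_col C"]) auto

lemma mat_distrib_left_dim:
  fixes A B C :: "'a::semiring_0 mat"
  shows "dim_col A = dim_row B \<Longrightarrow> dim_row B = dim_row C \<Longrightarrow> dim_col B = dim_col C
    \<Longrightarrow> A * (B + C) = A * B + A * C"
  by (rule mult_add_distrib_mat[of _ "dim_row A" "dim_col A" _ "dim_col B"]) auto

lemma mat_distrib_right_dim:
  fixes A B C :: "'a::semiring_0 mat"
  shows "dim_col A = dim_row C \<Longrightarrow> dim_row A = dim_row B \<Longrightarrow> dim_col A = dim_col B
    \<Longrightarrow> (A + B) * C = A * C + B * C"
  by (rule add_mult_distrib_mat[of _ "dim_row A" "dim_col A" _ _ "dim_col C"]) auto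

text \<open>Side conditions phrased through \<open>dim_row\<close> and \<open>dim_col\<close> are
  discharged by simplification, so long products are normalized without instantiating
  carriers.\<close>

lemmas mat_algebra_dim = mat_mult_assoc_dim mat_distrib_left_dim mat_distrib_right_dim

lemma ex_inverse_mat:
  fixes A :: "'a::field mat"
  assumes A: "A \<in> carrier_mat n n" and d: "det A \<noteq> 0"
  obtains B where "B \<in> carrier_mat n n" "A * B = 1\<^sub>m n" "B * A = 1\<^sub>m n"
  using det_non_zero_imp_unit[OF A d, where b = "()"] unfolding Units_def by (auto simp: ring_mat_def)

text \<open>Pairing the kernel equation of the Gram matrix with the conjugate of \<open>v\<close>
  gives the squared norm of \<open>U *\<^sub>v v\<close>, which must then be zero.\<close>

lemma gram_nonsingular:
  fixes U :: "complex mat"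
  assumes U: "U \<in> carrier_mat n k"
    and inj: "\<And>v. v \<in> carrier_vec k \<Longrightarrow> U *\<^sub>v v = 0\<^sub>v n \<Longrightarrow> v = 0\<^sub>v k"
  shows "det (transpose_mat (map_mat cnj U) * U) \<noteq> 0"
proof -
  let ?A = "map_mat cnj U"
  have "v = 0\<^sub>v k" if v: "v \<in> carrier_vec k" and eq: "(transpose_mat ?A * U) *\<^sub>v v = 0\<^sub>v k" for v
  proof -
    have Uv: "U *\<^sub>v v \<in> carrier_vec n" using U v by auto
    have "transpose_mat ?A *\<^sub>v (U *\<^sub>v v) = 0\<^sub>v k"
      using eq U v by (simp add: assoc_mult_mat_vec[of _ k n _ k])
    then have "(transpose_mat ?A *\<^sub>v (U *\<^sub>v v)) \<bullet> conjugate v = 0" using v by simp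
    then have "(U *\<^sub>v v) \<bullet> (?A *\<^sub>v conjugate v) = 0"
      using transpose_vec_mult_scalar[of ?A n k "conjugate v" "U *\<^sub>v v"] U v Uv by simp
    moreover have "?A *\<^sub>v conjugate v = conjugate (U *\<^sub>v v)"
      using U v by (intro eq_vecI) (auto simp: scalar_prod_def)
    ultimately have "U *\<^sub>v v = 0\<^sub>v n" using conjugate_square_eq_0_vec[OF Uv] by simp
    then show ?thesis using inj v by blast
  qed
  moreover have "transpose_mat ?A * U \<in> carrier_mat k k" using U by simp
  ultimately show ?thesis using det_nonzero_iff_kernel by blast
qed

text \<open>Replacing \<open>P\<close> and \<open>Q\<close> by invertible matrices only needs one generic point on the line to the
  identity; multiplying by their inverses then absorbs them.\<close>

lemma absorb_generic_factors:
  fixes N :: "'a::field_char_0 mat"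
  assumes N: "N \<in> carrier_mat n n" and B: "B \<in> carrier_mat n p" and C: "C \<in> carrier_mat q n"
    and P: "P \<in> carrier_mat n n" and Q: "Q \<in> carrier_mat n n"
    and Z: "Z \<in> carrier_mat n q" and W: "W \<in> carrier_mat p n"
    and G: "G \<in> carrier_mat n d" and H: "H \<in> carrier_mat d n"
    and nz: "det (P * (N * Q + B * W) + (Z * (C * Q) + G * H)) \<noteq> 0"
  shows "\<exists>W'\<in>carrier_mat p n. \<exists>Z'\<in>carrier_mat n q. \<exists>G'\<in>carrier_mat n d. \<exists>H'\<in>carrier_mat d n.
    det (N + (B * W' + Z' * C) + G' * H') \<noteq> 0"
proof -
  note dims [simp] = carrier_matD[OF N] carrier_matD[OF B] carrier_matD[OF C] carrier_matD[OF P]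
    carrier_matD[OF Q] carrier_matD[OF Z] carrier_matD[OF W] carrier_matD[OF G] carrier_matD[OF H]
  have line: "\<exists>R\<in>carrier_mat n n. det R \<noteq> 0 \<and> det (R * S + T) \<noteq> 0"
    if asm: "R0 \<in> carrier_mat n n" "S \<in> carrier_mat n n" "T \<in> carrier_mat n n" "det (R0 * S + T) \<noteq> 0"
    for R0 S T :: "'a mat"
  proof -
    define D where "D = 1\<^sub>m n + (-1) \<cdot>\<^sub>m R0"
    have D: "D \<in> carrier_mat n n" using asm by (simp add: D_def)
    have "(R0 * S + T) + 0 \<cdot>\<^sub>m (D * S) = R0 * S + T" using asm D by (intro eq_matI) auto
    moreover have "R0 + 1 \<cdot>\<^sub>m D = 1\<^sub>m n" using asm unfolding D_def by (intro eq_matI) auto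
    ultimately obtain t where t: "det ((R0 * S + T) + t \<cdot>\<^sub>m (D * S)) \<noteq> 0" "det (R0 + t \<cdot>\<^sub>m D) \<noteq> 0"
      using ex_det_line_nonzero2[of "R0 * S + T" n "D * S" 0 R0 n D 1] asm D by auto
    have "(R0 + t \<cdot>\<^sub>m D) * S = R0 * S + t \<cdot>\<^sub>m (D * S)"
      using asm D by (subst add_mult_distrib_mat[of _ n n _ _ n]) auto
    then have "(R0 + t \<cdot>\<^sub>m D) * S + T = (R0 * S + T) + t \<cdot>\<^sub>m (D * S)"
      using asm D by (auto intro!: eq_matI)
    moreover have "R0 + t \<cdot>\<^sub>m D \<in> carrier_mat n n" using asm D by auto
    ultimately show ?thesis using t by metis
  qed
  have "N * Q + B * W \<in> carrier_mat n n" "Z * (C * Q) + G * H \<in> carrier_mat n n"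
    by (intro carrier_matI; simp)+
  then obtain P2 where P2: "P2 \<in> carrier_mat n n" "det P2 \<noteq> 0"
    "det (P2 * (N * Q + B * W) + (Z * (C * Q) + G * H)) \<noteq> 0"
    using line[OF P _ _ nz] by metis
  note carrier_matD[OF P2(1), simp]
  define R where "R = P2 * N + Z * C"
  define T where "T = P2 * (B * W) + G * H"
  have RT: "R \<in> carrier_mat n n" "T \<in> carrier_mat n n"
    unfolding R_def T_def by (intro carrier_matI; simp)+
  have eq1: "P2 * (N * Q + B * W) + (Z * (C * Q) + G * H) = R * Q + T"
    unfolding R_def T_def by (simp add: mat_algebra_dim) (intro eq_matI, auto)
  \<comment> \<open>Transposition moves the right factor \<open>Q\<close> to the left, so
    \<open>line\<close> applies a second time.\<close>
  have transp: "transpose_mat (R * S + T) = transpose_mat S * transpose_mat R + transpose_mat T"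
    if "S \<in> carrier_mat n n" for S
    using RT that by (simp add: transpose_add[of _ n n] transpose_mult[of _ n n _ n])
  have "det (transpose_mat (R * Q + T)) \<noteq> 0"
    using P2(3) RT Q unfolding eq1 by (subst det_transpose[of _ n]) auto
  then obtain S where S: "S \<in> carrier_mat n n" "det S \<noteq> 0"
    "det (S * transpose_mat R + transpose_mat T) \<noteq> 0"
    using line[of "transpose_mat Q" "transpose_mat R" "transpose_mat T"] RT Q
    unfolding transp[OF Q] by auto
  define Q2 where "Q2 = transpose_mat S"
  have Q2: "Q2 \<in> carrier_mat n n" "det Q2 \<noteq> 0"
    using S det_transpose[OF S(1)] by (auto simp: Q2_def)
  have "transpose_mat (R * Q2 + T) = S * transpose_mat R + transpose_mat T"
    using transp[OF Q2(1)] by (simp add: Q2_def)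
  then have nz2: "det (R * Q2 + T) \<noteq> 0"
    using S(3) det_transpose[of "R * Q2 + T" n] RT Q2(1) by simp
  obtain P3 where P3: "P3 \<in> carrier_mat n n" "P2 * P3 = 1\<^sub>m n"
    using ex_inverse_mat[OF P2(1,2)] by metis
  obtain Q3 where Q3: "Q3 \<in> carrier_mat n n" "Q3 * Q2 = 1\<^sub>m n"
    using ex_inverse_mat[OF Q2] by metis
  note carrier_matD[OF Q2(1), simp] carrier_matD[OF P3(1), simp] carrier_matD[OF Q3(1), simp]
  have P32: "P2 * (P3 * X) = X" if "X \<in> carrier_mat n l" for X l
    using assoc_mult_mat[OF P2(1) P3(1) that] P3(2) that by simp
  \<comment> \<open>Cancelling \<open>P2\<close> on the left and \<open>Q2\<close> on the right
    leaves \<open>N\<close> bare; the inverses \<open>P3\<close> and \<open>Q3\<close> disappear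
    into the free factors.\<close>
  let ?X = "N + (B * (W * Q3) + (P3 * Z) * C) + (P3 * G) * (H * Q3)"
  have "P2 * ?X * Q2 = R * Q2 + T"
  proof -
    have "P2 * (P3 * (Z * (C * Q2))) = Z * (C * Q2)"
      by (rule P32[of _ n]) (intro carrier_matI; simp)
    moreover have "P2 * (P3 * (G * H)) = G * H"
      by (rule P32[of _ n]) (intro carrier_matI; simp)
    ultimately show ?thesis
      unfolding R_def T_def using Q3(2) right_mult_one_mat[OF H] right_mult_one_mat[OF W]
      by (simp add: mat_algebra_dim) (intro eq_matI, auto)
  qed
  moreover have X: "?X \<in> carrier_mat n n" by (intro carrier_matI) simp_all
  ultimately have "det P2 * det ?X * det Q2 \<noteq> 0"
    using nz2 det_mult[OF P2(1) X] det_mult[OF mult_carrier_mat[OF P2(1) X] Q2(1)] by metis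
  then have "det ?X \<noteq> 0" by auto
  moreover have "W * Q3 \<in> carrier_mat p n" "P3 * Z \<in> carrier_mat n q" "P3 * G \<in> carrier_mat n d"
    "H * Q3 \<in> carrier_mat d n" by (intro carrier_matI; simp)+
  ultimately show ?thesis by blast
qed

text \<open>Empty blocks let a block row or a block column be multiplied by the two-by-two rule;
  afterwards they are stripped off.\<close>

lemma four_block_mat_empty:
  assumes "A \<in> carrier_mat n 0" "B \<in> carrier_mat 0 k" "D \<in> carrier_mat 0 0"
  shows "four_block_mat X A B D = X"
proof -
  note [simp] = carrier_matD[OF assms(1)] carrier_matD[OF assms(2)] carrier_matD[OF assms(3)]
  show ?thesis by (rule eq_matI) simp_all
qed

text \<open>With \<open>k\<close> independent columns \<open>M * Q\<close> and \<open>P\<close>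
  their conjugate transpose, \<open>P * (M * Q)\<close> is a nonsingular \<open>k\<close> by
  \<open>k\<close> matrix. Padded to size \<open>n\<close> it reads
  \<open>P1 * (N * Q1 + B * W) + Z * (C * Q1)\<close>, the zero corner of \<open>M\<close> removing
  any product of \<open>Z\<close> and \<open>W\<close>. \<open>G * H\<close> fills the other
  \<open>n - k\<close> diagonal places, and \<open>absorb_generic_factors\<close> then removes
  \<open>P1\<close> and \<open>Q1\<close>.\<close>

lemma rank_ge_imp_update_nonsingular:
  fixes N :: "complex mat"
  assumes N: "N \<in> carrier_mat n n" and B: "B \<in> carrier_mat n p" and C: "C \<in> carrier_mat q n"
    and k: "k \<le> vec_space.rank (n + q) (four_block_mat N B C (0\<^sub>m q p))" and kn: "k \<le> n"
  shows "\<exists>Y\<in>updates n (set (cols B)) (set (rows C)).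
    \<exists>G\<in>carrier_mat n (n - k). \<exists>H\<in>carrier_mat (n - k) n. det (N + Y + G * H) \<noteq> 0"
proof -
  define M where "M = four_block_mat N B C (0\<^sub>m q p)"
  have M: "M \<in> carrier_mat (n + q) (n + p)" using N B C by (auto simp: M_def)
  obtain Q where Q: "Q \<in> carrier_mat (n + p) k"
    and inj: "\<And>v. v \<in> carrier_vec k \<Longrightarrow> (M * Q) *\<^sub>v v = 0\<^sub>v (n + q) \<Longrightarrow> v = 0\<^sub>v k"
    using vec_space.rank_ge_injective[OF M k[folded M_def]] by metis
  have MQ: "M * Q \<in> carrier_mat (n + q) k" using M Q by auto
  define P where "P = transpose_mat (map_mat cnj (M * Q))"
  have P: "P \<in> carrier_mat k (n + q)" using MQ by (auto simp: P_def)
  have nz: "det (P * (M * Q)) \<noteq> 0" using gram_nonsingular[OF MQ inj] by (simp add: P_def)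
  \<comment> \<open>\<open>P\<close> is cut after column \<open>n\<close> and padded to
    \<open>n\<close> rows; \<open>Q\<close> is cut after row \<open>n\<close> and padded to
    \<open>n\<close> columns.\<close>
  define P1 where "P1 = mat n n (\<lambda>(i,j). if i < k then P $$ (i,j) else 0)"
  define Z where "Z = mat n q (\<lambda>(i,j). if i < k then P $$ (i,n+j) else 0)"
  define Q1 where "Q1 = mat n n (\<lambda>(i,j). if j < k then Q $$ (i,j) else 0)"
  define W where "W = mat p n (\<lambda>(i,j). if j < k then Q $$ (n+i,j) else 0)"
  define G where "G = mat n (n - k) (\<lambda>(i,j). if i = k + j then 1 else 0 :: complex)"
  define H where "H = mat (n - k) n (\<lambda>(i,j). if j = k + i then 1 else 0 :: complex)"
  have carr: "P1 \<in> carrier_mat n n" "Z \<in> carrier_mat n q" "Q1 \<in> carrier_mat n n"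
    "W \<in> carrier_mat p n" "G \<in> carrier_mat n (n - k)" "H \<in> carrier_mat (n - k) n"
    by (auto simp: P1_def Z_def Q1_def W_def G_def H_def)
  define P' where "P' = four_block_mat P1 Z (0\<^sub>m 0 n) (0\<^sub>m 0 q)"
  define Q' where "Q' = four_block_mat Q1 (0\<^sub>m n 0) W (0\<^sub>m p 0)"
  have PQ: "P' \<in> carrier_mat n (n + q)" "Q' \<in> carrier_mat (n + p) n"
    unfolding P'_def Q'_def using carr by (metis add.right_neutral four_block_carrier_mat zero_carrier_mat)+
  have MQ': "M * Q' = four_block_mat (N * Q1 + B * W) (0\<^sub>m n 0) (C * Q1) (0\<^sub>m q 0)"
    unfolding M_def Q'_def using N B C carr
    by (subst mult_four_block_mat[of _ n n _ p _ q _ _ n _ 0]) (auto intro!: cong_four_block_mat eq_matI)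
  have "P' * (M * Q') = four_block_mat (P1 * (N * Q1 + B * W) + Z * (C * Q1)) (0\<^sub>m n 0) (0\<^sub>m 0 n) (0\<^sub>m 0 0)"
    unfolding MQ' P'_def using N B C carr
    by (subst mult_four_block_mat[of _ n n _ q _ 0 _ _ n _ 0]) (auto intro!: cong_four_block_mat eq_matI)
  also have "\<dots> = P1 * (N * Q1 + B * W) + Z * (C * Q1)"
    by (rule four_block_mat_empty[of _ n _ n]) auto
  finally have prod: "P' * (M * Q') = P1 * (N * Q1 + B * W) + Z * (C * Q1)" .
  have rowP: "row P' i = (if i < k then row P i else 0\<^sub>v (n + q))" if "i < n" for i
    using that P PQ(1) kn unfolding P'_def by (intro eq_vecI) (auto simp: P1_def Z_def)
  have colQ: "col Q' j = (if j < k then col Q j else 0\<^sub>v (n + p))" if "j < n" for j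
    using that Q PQ(2) kn unfolding Q'_def by (intro eq_vecI) (auto simp: Q1_def W_def)
  have GH: "(G * H) $$ (i,j) = (if i = j \<and> k \<le> i then 1 else 0)" if "i < n" "j < n" for i j
  proof -
    have "(G * H) $$ (i,j) = (\<Sum>t\<in>{0..<n - k}. if t = i - k \<and> k \<le> i then (if i = j then 1 else 0) else 0)"
      using that carr by (auto simp: scalar_prod_def G_def H_def intro!: sum.cong)
    also have "\<dots> = (if i = j \<and> k \<le> i then 1 else 0)"
      using that by (cases "k \<le> i") auto
    finally show ?thesis .
  qed
  have "P' * (M * Q') + G * H = four_block_mat (P * (M * Q)) (0\<^sub>m k (n - k)) (0\<^sub>m (n - k) k) (1\<^sub>m (n - k))"
    (is "?L = ?R")
  proof (rule eq_matI)
    fix i j assume "i < dim_row ?R" "j < dim_col ?R"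
    then have ij: "i < n" "j < n" using P MQ kn by auto
    have "(P' * (M * Q')) $$ (i,j) = (if i < k \<and> j < k then (P * (M * Q)) $$ (i,j) else 0)"
    proof -
      have "(P' * (M * Q')) $$ (i,j) = row P' i \<bullet> col (M * Q') j"
        using ij PQ M by (intro index_mult_mat(1)) auto
      also have "col (M * Q') j = M *\<^sub>v col Q' j" by (rule col_mult2[OF M PQ(2) ij(2)])
      finally have "(P' * (M * Q')) $$ (i,j) = row P' i \<bullet> (M *\<^sub>v col Q' j)" .
      moreover have "(P * (M * Q)) $$ (i,j) = row P i \<bullet> (M *\<^sub>v col Q j)" if "i < k" "j < k"
      proof -
        have "(P * (M * Q)) $$ (i,j) = row P i \<bullet> col (M * Q) j"
          using that P Q M by (intro index_mult_mat(1)) auto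
        then show ?thesis using col_mult2[OF M Q that(2)] by metis
      qed
      moreover have "M *\<^sub>v 0\<^sub>v (n + p) = 0\<^sub>v (n + q)" using M by (intro eq_vecI) auto
      moreover have "row P i \<in> carrier_vec (n + q)" "M *\<^sub>v col Q' j \<in> carrier_vec (n + q)"
        using P M by (auto intro!: carrier_vecI)
      ultimately show ?thesis using rowP[OF ij(1)] colQ[OF ij(2)] by auto
    qed
    moreover have "?L $$ (i,j) = (P' * (M * Q')) $$ (i,j) + (G * H) $$ (i,j)"
      using ij PQ M carr by simp
    moreover have "?R $$ (i,j) = (if i < k \<and> j < k then (P * (M * Q)) $$ (i,j) else 0)
        + (if i = j \<and> k \<le> i then 1 else 0)"
      using ij P MQ kn by (subst index_mat_four_block) auto
    ultimately show "?L $$ (i,j) = ?R $$ (i,j)" using GH[OF ij] by simp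
  qed (use PQ M carr P MQ kn in auto)
  moreover have "det ?R = det (P * (M * Q))"
    using P MQ by (subst det_four_block_mat_upper_right_zero[of _ k _ "n - k"]) auto
  ultimately have "det (P' * (M * Q') + G * H) \<noteq> 0" using nz by simp
  moreover have "P' * (M * Q') + G * H = P1 * (N * Q1 + B * W) + (Z * (C * Q1) + G * H)"
    unfolding prod using N B C carr by (intro eq_matI) auto
  ultimately obtain W' Z' G' H' where WZ: "W' \<in> carrier_mat p n" "Z' \<in> carrier_mat n q"
    "G' \<in> carrier_mat n (n - k)" "H' \<in> carrier_mat (n - k) n"
    "det (N + (B * W' + Z' * C) + G' * H') \<noteq> 0"
    using absorb_generic_factors[OF N B C carr(1) carr(3) carr(2) carr(4) carr(5) carr(6)] by metis
  moreover have "B * W' + Z' * C \<in> updates n (set (cols B)) (set (rows C))"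
    using WZ B C by (intro updates_add updates_mult_left[of _ _ p] updates_mult_right[of _ _ q]) auto
  ultimately show ?thesis by blast
qed

text \<open>In a rank factorization \<open>M = X * Y\<close>, the rows of \<open>X\<close> and the
  columns of \<open>Y\<close> are cut like \<open>M\<close>. The upper left block gives
  \<open>N = U1 * V1\<close>, the off-diagonal blocks express the columns of \<open>B\<close> and
  the rows of \<open>C\<close>, and the zero corner is the orthogonality of \<open>U\<close> and
  \<open>V\<close>. This is what \<open>updates_factorization\<close> takes as input.\<close>

lemma block_rank_factorization:
  fixes N :: "'a::field mat"
  assumes N: "N \<in> carrier_mat n n" and B: "B \<in> carrier_mat n p" and C: "C \<in> carrier_mat q n"
  defines "r \<equiv> vec_space.rank (n + q) (four_block_mat N B C (0\<^sub>m q p))"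
  obtains U1 V1 U V where "U1 \<in> carrier_mat n r" "V1 \<in> carrier_mat r n" "N = U1 * V1"
    "V \<subseteq> carrier_vec r" "U \<subseteq> carrier_vec r"
    "set (cols B) \<subseteq> (\<lambda>v. U1 *\<^sub>v v) ` V" "set (rows C) \<subseteq> (\<lambda>u. transpose_mat V1 *\<^sub>v u) ` U"
    "\<And>u v. u \<in> U \<Longrightarrow> v \<in> V \<Longrightarrow> u \<bullet> v = 0"
proof -
  define M where "M = four_block_mat N B C (0\<^sub>m q p)"
  have M: "M \<in> carrier_mat (n + q) (n + p)" using N B C by (auto simp: M_def)
  obtain X Y where XY: "X \<in> carrier_mat (n + q) r" "Y \<in> carrier_mat r (n + p)" "M = X * Y"
    using vec_space.rank_factorization[OF M] unfolding r_def M_def by metis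
  have entry: "M $$ (i,j) = row X i \<bullet> col Y j" if "i < n + q" "j < n + p" for i j
    unfolding XY(3) using that XY(1,2) by simp
  define U1 where "U1 = mat n r (\<lambda>(i,j). X $$ (i,j))"
  define V1 where "V1 = mat r n (\<lambda>(i,j). Y $$ (i,j))"
  have U1: "U1 \<in> carrier_mat n r" "row U1 i = row X i" if "i < n" for i
    using that XY by (auto simp: U1_def intro!: eq_vecI)
  have U1c: "U1 \<in> carrier_mat n r" and V1c: "V1 \<in> carrier_mat r n"
    by (auto simp: U1_def V1_def)
  have V1: "col V1 j = col Y j" if "j < n" for j
    using that XY by (auto simp: V1_def intro!: eq_vecI)
  let ?V = "(\<lambda>j. col Y (n + j)) ` {..<p}" and ?U = "(\<lambda>i. row X (n + i)) ` {..<q}"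
  have "N = U1 * V1"
    using N U1c V1c U1(2) V1 M by (intro eq_matI) (auto simp: entry[symmetric] M_def)
  moreover have "set (cols B) \<subseteq> (\<lambda>v. U1 *\<^sub>v v) ` ?V"
  proof
    fix b assume "b \<in> set (cols B)"
    then obtain j where j: "j < p" "b = col B j" using B by (auto simp: cols_def)
    have "b = U1 *\<^sub>v col Y (n + j)"
      using j N B C U1c U1(2) by (intro eq_vecI) (auto simp: entry[symmetric] M_def)
    then show "b \<in> (\<lambda>v. U1 *\<^sub>v v) ` ?V" using j by blast
  qed
  moreover have "set (rows C) \<subseteq> (\<lambda>u. transpose_mat V1 *\<^sub>v u) ` ?U"
  proof
    fix c assume "c \<in> set (rows C)"
    then obtain i where i: "i < q" "c = row C i" using C by (auto simp: rows_def)
    have "c = transpose_mat V1 *\<^sub>v row X (n + i)"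
    proof (rule eq_vecI)
      fix j assume "j < dim_vec (transpose_mat V1 *\<^sub>v row X (n + i))"
      then have j: "j < n" using V1c by simp
      have "col Y j \<bullet> row X (n + i) = row X (n + i) \<bullet> col Y j"
        using XY by (intro comm_scalar_prod[of _ r]) auto
      then show "c $ j = (transpose_mat V1 *\<^sub>v row X (n + i)) $ j"
        using i j N B C V1c V1[OF j] by (auto simp: entry[symmetric] M_def)
    qed (use i C V1c in auto)
    then show "c \<in> (\<lambda>u. transpose_mat V1 *\<^sub>v u) ` ?U" using i by blast
  qed
  moreover have "u \<bullet> v = 0" if "u \<in> ?U" "v \<in> ?V" for u v
    using that N B C by (auto simp: entry[symmetric] M_def)
  moreover have "?V \<subseteq> carrier_vec r" "?U \<subseteq> carrier_vec r" using XY by auto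
  ultimately show thesis using that[OF U1c V1c, of ?V ?U] by blast
qed

section \<open>Fixed spectrum under decentralized feedback\<close>

text \<open>The same fold as in \<open>fixed_spectrum\<close>, with the state dimension as an
  argument, so that the sum there can be folded back into this constant.\<close>

definition feedback :: "nat \<Rightarrow> nat \<Rightarrow> (nat \<Rightarrow> real mat) \<Rightarrow> (nat \<Rightarrow> real mat) \<Rightarrow> (nat \<Rightarrow> real mat) \<Rightarrow> real mat" where
  "feedback n m B C F = foldr (\<lambda>i X. B i * F i * C i + X) [0..<m] (0\<^sub>m n n)"

definition input_cols :: "(nat \<Rightarrow> real mat) \<Rightarrow> nat set \<Rightarrow> complex vec set" where
  "input_cols B s = (\<Union>i\<in>s. set (cols (cmat (B i))))"

definition output_rows :: "(nat \<Rightarrow> real mat) \<Rightarrow> nat set \<Rightarrow> complex vec set" where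
  "output_rows C s = (\<Union>i\<in>s. set (rows (cmat (C i))))"

lemma cmat_carrier [simp]: "cmat M \<in> carrier_mat r c \<longleftrightarrow> M \<in> carrier_mat r c"
  by (auto simp: cmat_def)

lemma dim_cmat [simp]: "dim_row (cmat M) = dim_row M" "dim_col (cmat M) = dim_col M"
  by (auto simp: cmat_def)

lemma cmat_add: "M \<in> carrier_mat r c \<Longrightarrow> N \<in> carrier_mat r c \<Longrightarrow> cmat (M + N) = cmat M + cmat N"
  by (auto simp: cmat_def intro!: eq_matI)

lemma cmat_mult: "M \<in> carrier_mat r k \<Longrightarrow> N \<in> carrier_mat k c \<Longrightarrow> cmat (M * N) = cmat M * cmat N"
  unfolding cmat_def by (rule of_real_hom.mat_hom_mult)

context
  fixes n m :: nat and B C :: "nat \<Rightarrow> real mat" and p q :: "nat \<Rightarrow> nat"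
  assumes B: "\<And>i. i < m \<Longrightarrow> B i \<in> carrier_mat n (p i)"
    and C: "\<And>i. i < m \<Longrightarrow> C i \<in> carrier_mat (q i) n"
begin

lemma foldr_feedback:
  assumes F: "\<And>i. i < m \<Longrightarrow> F i \<in> carrier_mat (p i) (q i)" and xs: "set xs \<subseteq> {..<m}"
  shows "foldr (\<lambda>i X. B i * F i * C i + X) xs (0\<^sub>m n n) =
    mat n n (\<lambda>ij. \<Sum>i\<leftarrow>xs. (B i * F i * C i) $$ ij)"
  using xs
proof (induction xs)
  case (Cons i xs)
  then have "B i * F i * C i \<in> carrier_mat n n" using B[of i] C[of i] F[of i] by auto
  then show ?case using Cons by (intro eq_matI) auto
qed (auto intro: eq_matI)

lemma feedback_eq:
  assumes F: "\<And>i. i < m \<Longrightarrow> F i \<in> carrier_mat (p i) (q i)"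
  shows "feedback n m B C F = mat n n (\<lambda>ij. \<Sum>i<m. (B i * F i * C i) $$ ij)"
  unfolding feedback_def
  by (subst foldr_feedback[OF F]) (auto simp: interv_sum_list_conv_sum_set_nat atLeast0LessThan)

text \<open>The same feedback serves every \<open>s\<close>: for \<open>i \<in> s\<close> the factor
  \<open>F i * C i\<close> counts as free, otherwise the factor \<open>B i * F i\<close>
  does.\<close>

lemma feedback_in_updates:
  assumes F: "\<And>i. i < m \<Longrightarrow> F i \<in> carrier_mat (p i) (q i)"
  shows "cmat (feedback n m B C F) \<in> updates n (input_cols B s) (output_rows C ({..<m} - s))"
proof -
  have "cmat (foldr (\<lambda>i X. B i * F i * C i + X) xs (0\<^sub>m n n))
      \<in> updates n (input_cols B s) (output_rows C ({..<m} - s))" if "set xs \<subseteq> {..<m}" for xs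
    using that
  proof (induction xs)
    case Nil
    have "cmat (0\<^sub>m n n) = 0\<^sub>m n n" by (auto simp: cmat_def intro!: eq_matI)
    then show ?case by (simp add: updates.zero)
  next
    case (Cons i xs)
    then have i: "i < m" by simp
    let ?X = "foldr (\<lambda>i X. B i * F i * C i + X) xs (0\<^sub>m n n)"
    have X: "?X \<in> carrier_mat n n" using foldr_feedback[OF F, of xs] Cons.prems by simp
    have "cmat (B i * F i * C i) \<in> updates n (input_cols B s) (output_rows C ({..<m} - s))"
    proof (cases "i \<in> s")
      case True
      have "cmat (B i * F i * C i) = cmat (B i) * cmat (F i * C i)"
        using B[OF i] C[OF i] F[OF i]
        by (simp add: assoc_mult_mat[of _ n "p i" _ "q i" _ n] cmat_mult[of _ n "p i" _ n])
      moreover have "set (cols (cmat (B i))) \<subseteq> input_cols B s"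
        using True by (auto simp: input_cols_def)
      ultimately show ?thesis
        using B[OF i] C[OF i] F[OF i] updates_mult_left[of "cmat (B i)" n "p i" "cmat (F i * C i)"] by simp
    next
      case False
      have "cmat (B i * F i * C i) = cmat (B i * F i) * cmat (C i)"
        using B[OF i] C[OF i] F[OF i] by (intro cmat_mult[of _ n "q i" _ n]) auto
      moreover have "set (rows (cmat (C i))) \<subseteq> output_rows C ({..<m} - s)"
        using False i by (auto simp: output_rows_def)
      ultimately show ?thesis
        using B[OF i] C[OF i] F[OF i] updates_mult_right[of "cmat (B i * F i)" n "q i" "cmat (C i)"] by simp
    qed
    moreover have "cmat (B i * F i * C i + ?X) = cmat (B i * F i * C i) + cmat ?X"
      using B[OF i] C[OF i] F[OF i] X by (intro cmat_add[of _ n n]) auto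
    ultimately show ?case using Cons by (auto intro: updates_add)
  qed
  then show ?thesis unfolding feedback_def by (metis atLeast_upt order_refl)
qed

text \<open>The triple \<open>(i,k,l)\<close> names entry \<open>(k,l)\<close> of the gain
  \<open>F i\<close>. Raising that entry by \<open>f\<close> adds \<open>f\<close> times the product
  of column \<open>k\<close> of \<open>B i\<close> and row \<open>l\<close> of
  \<open>C i\<close>.\<close>

lemma real_updates_imp_feedback:
  assumes "Y \<in> real_updates (\<lambda>(i,k,l). col (cmat (B i)) k) (\<lambda>(i,k,l). row (cmat (C i)) l) n
    {(i,k,l). i < m \<and> k < p i \<and> l < q i}"
  shows "\<exists>F. (\<forall>i<m. F i \<in> carrier_mat (p i) (q i)) \<and> Y = cmat (feedback n m B C F)"
  using assms
proof induction
  case zero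
  let ?F = "\<lambda>i. 0\<^sub>m (p i) (q i)"
  have "B i * ?F i * C i = 0\<^sub>m n n" if "i < m" for i using B[OF that] C[OF that] by simp
  then have "0\<^sub>m n n = cmat (feedback n m B C ?F)"
    by (subst feedback_eq) (auto simp: cmat_def intro!: eq_matI)
  then show ?case by (intro exI[of _ ?F]) simp
next
  case (step Y j f)
  obtain i k l where j: "j = (i,k,l)" and i: "i < m" "k < p i" "l < q i" using step(2) by auto
  obtain F where F: "\<And>i. i < m \<Longrightarrow> F i \<in> carrier_mat (p i) (q i)"
    "Y = cmat (feedback n m B C F)" using step by blast
  let ?E = "outer (unit_vec (p i) k) (f \<cdot>\<^sub>v unit_vec (q i) l)"
  define F' where "F' = F(i := F i + ?E)"
  have F': "F' i' \<in> carrier_mat (p i') (q i')" if "i' < m" for i'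
    using F(1)[OF that] F(1)[OF i(1)] by (auto simp: F'_def)
  have R: "outer (col (B i) k) (f \<cdot>\<^sub>v row (C i) l) \<in> carrier_mat n n"
    using B[OF i(1)] C[OF i(1)] by (auto intro!: outer_carrier)
  have "B i * ?E * C i = outer (col (B i) k) (f \<cdot>\<^sub>v row (C i) l)"
  proof -
    have "B i * ?E = outer (col (B i) k) (f \<cdot>\<^sub>v unit_vec (q i) l)"
      using B[OF i(1)] i by (simp add: mult_outer[of _ n "p i" _ _ "q i"] mult_mat_unit_vec[of _ n])
    moreover have "transpose_mat (C i) *\<^sub>v (f \<cdot>\<^sub>v unit_vec (q i) l) = f \<cdot>\<^sub>v row (C i) l"
      using C[OF i(1)] i
      by (simp add: mult_mat_vec[of _ n "q i"] mult_mat_unit_vec[of _ n "q i"])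
    ultimately show ?thesis
      using B[OF i(1)] C[OF i(1)] i by (simp add: outer_mult[of _ "q i" n _ n])
  qed
  then have upd: "B i * F' i * C i = B i * F i * C i + outer (col (B i) k) (f \<cdot>\<^sub>v row (C i) l)"
    using B[OF i(1)] C[OF i(1)] F(1)[OF i(1)]
    by (simp add: F'_def mult_add_distrib_mat[of _ n "p i" _ "q i"]
        add_mult_distrib_mat[of _ n "q i" _ _ n])
  have sum: "(\<Sum>t<m. (B t * F' t * C t) $$ ij) =
      (\<Sum>t<m. (B t * F t * C t) $$ ij) + outer (col (B i) k) (f \<cdot>\<^sub>v row (C i) l) $$ ij"
    if ij: "ij \<in> {..<n} \<times> {..<n}" for ij
  proof -
    have "(\<Sum>t<m. (B t * F' t * C t) $$ ij) =
        (B i * F' i * C i) $$ ij + (\<Sum>t\<in>{..<m} - {i}. (B t * F' t * C t) $$ ij)"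
      using i by (intro sum.remove) auto
    also have "(\<Sum>t\<in>{..<m} - {i}. (B t * F' t * C t) $$ ij) =
        (\<Sum>t\<in>{..<m} - {i}. (B t * F t * C t) $$ ij)"
      by (intro sum.cong) (auto simp: F'_def)
    also have "(B i * F' i * C i) $$ ij =
        (B i * F i * C i) $$ ij + outer (col (B i) k) (f \<cdot>\<^sub>v row (C i) l) $$ ij"
      unfolding upd using ij B[OF i(1)] C[OF i(1)] by (auto simp del: index_mult_mat(1))
    finally show ?thesis using i sum.remove[of "{..<m}" i "\<lambda>t. (B t * F t * C t) $$ ij"] by simp
  qed
  have "Y + complex_of_real f \<cdot>\<^sub>m outer (col (cmat (B i)) k) (row (cmat (C i)) l) =
      cmat (feedback n m B C F')"
  proof -
    note fb = feedback_eq[of F, OF F(1)] feedback_eq[of F', OF F']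
    show ?thesis
      unfolding F(2) using fb B[OF i(1)] C[OF i(1)] i sum
      by (intro eq_matI) (auto simp: cmat_def)
  qed
  then show ?case using F' unfolding j by auto
qed

text \<open>A good gain supplies one correction for all \<open>s\<close>. Conversely, the criterion
  over sets of channels implies the finer one over sets \<open>J\<close> of gain entries, from which
  \<open>generic_rank1_updates\<close> produces a real gain.\<close>

lemma not_in_fixed_spectrum_iff:
  assumes A: "A \<in> carrier_mat n n"
  shows "lam \<notin> fixed_spectrum m A B C \<longleftrightarrow>
    (\<forall>s\<subseteq>{..<m}. \<exists>Y\<in>updates n (input_cols B s) (output_rows C ({..<m} - s)).
      det (char_matrix (cmat A) lam + Y) \<noteq> 0)"
    (is "?L \<longleftrightarrow> ?R")
proof -
  have fb: "feedback n m B C F \<in> carrier_mat n n" if "\<And>i. i < m \<Longrightarrow> F i \<in> carrier_mat (p i) (q i)" for F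
    using feedback_eq[OF that] by simp
  have ev: "eigenvalue (cmat (A + feedback n m B C F)) lam \<longleftrightarrow>
      det (char_matrix (cmat A) lam + cmat (feedback n m B C F)) = 0"
    if "\<And>i. i < m \<Longrightarrow> F i \<in> carrier_mat (p i) (q i)" for F
  proof -
    have "char_matrix (cmat (A + feedback n m B C F)) lam =
        char_matrix (cmat A) lam + cmat (feedback n m B C F)"
      using A fb[OF that] by (auto simp: char_matrix_def cmat_def intro!: eq_matI)
    then show ?thesis using A fb[OF that] eigenvalue_det[of "cmat (A + feedback n m B C F)" n lam] by simp
  qed
  have dims: "(\<forall>i<m. F i \<in> carrier_mat (dim_col (B i)) (dim_row (C i))) \<longleftrightarrow>
      (\<forall>i<m. F i \<in> carrier_mat (p i) (q i))" for F
    using B C by (metis carrier_matD)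
  have L: "?L \<longleftrightarrow> (\<exists>F. (\<forall>i<m. F i \<in> carrier_mat (p i) (q i)) \<and>
      det (char_matrix (cmat A) lam + cmat (feedback n m B C F)) \<noteq> 0)"
    unfolding fixed_spectrum_def dims carrier_matD(1)[OF A] feedback_def[symmetric]
    using ev by auto
  show ?thesis
  proof
    assume ?L
    then show ?R unfolding L using feedback_in_updates by blast
  next
    assume R: ?R
    let ?T = "{(i,k,l). i < m \<and> k < p i \<and> l < q i}"
    let ?b = "\<lambda>(i,k,l::nat). col (cmat (B i)) k" and ?c = "\<lambda>(i,k::nat,l). row (cmat (C i)) l"
    have "?T \<subseteq> (SIGMA i:{..<m}. {..<p i} \<times> {..<q i})" by auto
    then have fin: "finite ?T" by (rule finite_subset) auto
    have "\<exists>Y\<in>real_updates ?b ?c n ?T. det (char_matrix (cmat A) lam + Y) \<noteq> 0"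
    proof (rule generic_rank1_updates[OF fin])
      show "char_matrix (cmat A) lam \<in> carrier_mat n n" using A by (simp add: char_matrix_def)
      show "?b j \<in> carrier_vec n \<and> ?c j \<in> carrier_vec n" if "j \<in> ?T" for j
        using that carrier_matD[OF B] carrier_matD[OF C] by (auto intro!: carrier_vecI)
      fix J assume J: "J \<subseteq> ?T"
      \<comment> \<open>Channel \<open>i\<close> enters \<open>s\<close> when all its input columns
        occur in \<open>J\<close>. Otherwise some column \<open>k\<close> has no
        \<open>(i,k,l)\<close> in \<open>J\<close>, and then all output rows of channel
        \<open>i\<close> occur in the complement of \<open>J\<close>.\<close>
      define s where "s = {i. i < m \<and> (\<forall>k<p i. \<exists>l. (i,k,l) \<in> J)}"
      have "s \<subseteq> {..<m}" by (auto simp: s_def)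
      then obtain Y where Y: "Y \<in> updates n (input_cols B s) (output_rows C ({..<m} - s))"
        "det (char_matrix (cmat A) lam + Y) \<noteq> 0" using R by blast
      have "input_cols B s \<subseteq> ?b ` J"
      proof
        fix v assume "v \<in> input_cols B s"
        then obtain i where i: "i \<in> s" "v \<in> set (cols (cmat (B i)))" by (auto simp: input_cols_def)
        then have "i < m" by (simp add: s_def)
        then obtain k where k: "k < p i" "v = col (cmat (B i)) k"
          using i(2) B[of i] by (auto simp: cols_def)
        obtain l where "(i,k,l) \<in> J" using i(1) k(1) by (auto simp: s_def)
        then have "?b (i,k,l) \<in> ?b ` J" by (rule imageI)
        then show "v \<in> ?b ` J" using k(2) by simp
      qed
      moreover have "output_rows C ({..<m} - s) \<subseteq> ?c ` (?T - J)"
      proof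
        fix v assume "v \<in> output_rows C ({..<m} - s)"
        then obtain i where i: "i < m" "i \<notin> s" "v \<in> set (rows (cmat (C i)))"
          by (auto simp: output_rows_def)
        then obtain l where l: "l < q i" "v = row (cmat (C i)) l"
          using C[of i] by (auto simp: rows_def)
        obtain k where k: "k < p i" "\<forall>l. (i,k,l) \<notin> J" using i(1,2) by (auto simp: s_def)
        then have "(i,k,l) \<in> ?T - J" using i l by auto
        then have "?c (i,k,l) \<in> ?c ` (?T - J)" by (rule imageI)
        then show "v \<in> ?c ` (?T - J)" using l(2) by simp
      qed
      ultimately show "\<exists>Y\<in>updates n (?b ` J) (?c ` (?T - J)). det (char_matrix (cmat A) lam + Y) \<noteq> 0"
        using updates_mono[OF Y(1)] Y(2) by blast
    qed
    then show ?L unfolding L using real_updates_imp_feedback by blast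
  qed
qed

end

section \<open>Adding integrator states\<close>

text \<open>The shape of the columns of the extended inputs and of the rows of the extended outputs;
  \<open>I\<close> collects the extra states that are driven, respectively measured.\<close>

definition ext_vecs :: "nat \<Rightarrow> nat \<Rightarrow> 'a::zero_neq_one vec set \<Rightarrow> nat set \<Rightarrow> 'a vec set" where
  "ext_vecs n \<nu> V I = (\<lambda>v. v @\<^sub>v 0\<^sub>v \<nu>) ` V \<union> (\<lambda>r. 0\<^sub>v n @\<^sub>v unit_vec \<nu> r) ` I"

text \<open>For \<open>N = lam I - A\<close> and \<open>a = lam\<close> this is
  \<open>lam I - Abar\<close>, the extra states being integrators in open loop. With
  \<open>a = 0\<close> it embeds corrections of the original system.\<close>

definition diag_ext :: "'a::comm_ring_1 mat \<Rightarrow> nat \<Rightarrow> 'a \<Rightarrow> 'a mat" where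
  "diag_ext N \<nu> a =
    four_block_mat N (0\<^sub>m (dim_row N) \<nu>) (0\<^sub>m \<nu> (dim_col N)) (a \<cdot>\<^sub>m 1\<^sub>m \<nu>)"

lemma updates_diag_ext:
  assumes "Y \<in> updates n Bs Cs"
  shows "diag_ext Y \<nu> 0 \<in> updates (n + \<nu>) (ext_vecs n \<nu> Bs I) (ext_vecs n \<nu> Cs I')"
  using assms
proof induction
  case zero
  have "diag_ext (0\<^sub>m n n) \<nu> (0::'a) = 0\<^sub>m (n + \<nu>) (n + \<nu>)"
    by (intro eq_matI) (auto simp: diag_ext_def)
  then show ?case by (simp add: updates.zero)
next
  case (left Y b w)
  have "diag_ext (Y + outer b w) \<nu> 0 = diag_ext Y \<nu> 0 + outer (b @\<^sub>v 0\<^sub>v \<nu>) (w @\<^sub>v 0\<^sub>v \<nu>)"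
    using updates_carrier[OF left(1)] left(3,4) by (intro eq_matI) (auto simp: diag_ext_def)
  moreover have "b @\<^sub>v 0\<^sub>v \<nu> \<in> ext_vecs n \<nu> Bs I" using left(2) by (simp add: ext_vecs_def)
  ultimately show ?case using left by (simp add: updates.left)
next
  case (right Y c z)
  have "diag_ext (Y + outer z c) \<nu> 0 = diag_ext Y \<nu> 0 + outer (z @\<^sub>v 0\<^sub>v \<nu>) (c @\<^sub>v 0\<^sub>v \<nu>)"
    using updates_carrier[OF right(1)] right(3,4) by (intro eq_matI) (auto simp: diag_ext_def)
  moreover have "c @\<^sub>v 0\<^sub>v \<nu> \<in> ext_vecs n \<nu> Cs I'" using right(2) by (simp add: ext_vecs_def)
  ultimately show ?case using right by (simp add: updates.right)
qed

text \<open>Each extra state is driven or measured, so its diagonal entry is a term with a permitted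
  left factor or with a permitted right factor.\<close>

lemma updates_scalar_block:
  assumes cover: "{..<\<nu>} \<subseteq> I \<union> I'"
  shows "diag_ext (0\<^sub>m n n) \<nu> a \<in> updates (n + \<nu>) (ext_vecs n \<nu> Bs I) (ext_vecs n \<nu> Cs I')"
proof -
  let ?U = "updates (n + \<nu>) (ext_vecs n \<nu> Bs I) (ext_vecs n \<nu> Cs I')"
  let ?D = "\<lambda>l. mat (n + \<nu>) (n + \<nu>) (\<lambda>(i,j). if i = j \<and> n \<le> i \<and> i < n + l then a else 0)"
  have "?D l \<in> ?U" if "l \<le> \<nu>" for l
    using that
  proof (induction l)
    case 0
    have "?D 0 = 0\<^sub>m (n + \<nu>) (n + \<nu>)" by (intro eq_matI) auto
    then show ?case using updates.zero by metis
  next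
    case (Suc l)
    then have l: "l < \<nu>" and IH: "?D l \<in> ?U" by auto
    let ?e = "0\<^sub>v n @\<^sub>v unit_vec \<nu> l :: 'a vec"
    have e: "?e \<in> carrier_vec (n + \<nu>)" by simp
    have split: "?D (Suc l) = ?D l + a \<cdot>\<^sub>m outer ?e ?e"
      using l by (intro eq_matI) (auto simp: unit_vec_def)
    consider "l \<in> I" | "l \<in> I'" using cover l by auto
    then show ?case
    proof cases
      case 1
      then have "?e \<in> ext_vecs n \<nu> Bs I" by (simp add: ext_vecs_def)
      then show ?thesis unfolding split smult_outer using IH e by (intro updates.left) auto
    next
      case 2
      then have "?e \<in> ext_vecs n \<nu> Cs I'" by (simp add: ext_vecs_def)
      then show ?thesis unfolding split smult_outer' using IH e by (intro updates.right) auto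
    qed
  qed
  then have "?D \<nu> \<in> ?U" by simp
  moreover have "?D \<nu> = diag_ext (0\<^sub>m n n) \<nu> a" by (intro eq_matI) (auto simp: diag_ext_def)
  ultimately show ?thesis by simp
qed

text \<open>The indices common to \<open>I\<close> and \<open>I'\<close> make a coupling through the extra states possible: with
  \<open>-1\<close> in the lower right corner, the Schur complement of the extended matrix is \<open>N + Y + G * H\<close>.\<close>

lemma ext_nonsingular:
  fixes N :: "'a::field mat"
  assumes N: "N \<in> carrier_mat n n" and cover: "{..<\<nu>} \<subseteq> I \<union> I'"
    and I: "I \<subseteq> {..<\<nu>}" and d: "d \<le> card (I \<inter> I')"
    and Y: "Y \<in> updates n Bs Cs" and G: "G \<in> carrier_mat n d" and H: "H \<in> carrier_mat d n"
    and nz: "det (N + Y + G * H) \<noteq> 0"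
  shows "\<exists>Y'\<in>updates (n + \<nu>) (ext_vecs n \<nu> Bs I) (ext_vecs n \<nu> Cs I').
    det (diag_ext N \<nu> a + Y') \<noteq> 0"
proof -
  let ?U = "updates (n + \<nu>) (ext_vecs n \<nu> Bs I) (ext_vecs n \<nu> Cs I')"
  have "finite (I \<inter> I')" using I finite_subset by auto
  \<comment> \<open>\<open>r\<close> chooses \<open>d\<close> distinct extra states that are both
    driven and measured. Their unit vectors are the columns of \<open>S\<close>, whence
    \<open>SS\<close>.\<close>
  then obtain r where r: "inj_on r {..<d}" "r ` {..<d} \<subseteq> I \<inter> I'"
    using card_le_inj[of "{..<d}" "I \<inter> I'"] d by auto
  have rI: "r t \<in> I" "r t \<in> I'" "r t < \<nu>" if "t < d" for t using r(2) that I by auto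
  define S where "S = mat \<nu> d (\<lambda>(i,t). if i = r t then 1 else 0 :: 'a)"
  have S: "S \<in> carrier_mat \<nu> d" by (simp add: S_def)
  have SS: "transpose_mat S * S = 1\<^sub>m d"
  proof (rule eq_matI)
    fix i j assume "i < dim_row (1\<^sub>m d :: 'a mat)" "j < dim_col (1\<^sub>m d :: 'a mat)"
    then have ij: "i < d" "j < d" by auto
    have "(transpose_mat S * S) $$ (i,j) = (\<Sum>k\<in>{0..<\<nu>}. S $$ (k,i) * S $$ (k,j))"
      using ij S by (simp add: scalar_prod_def)
    also have "\<dots> = (\<Sum>k\<in>{0..<\<nu>}. if k = r i then (if i = j then 1 else 0) else 0)"
      using ij r(1) by (intro sum.cong refl) (auto simp: S_def inj_on_def)
    finally show "(transpose_mat S * S) $$ (i,j) = 1\<^sub>m d $$ (i,j)" using ij rI(3) by simp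
  qed (auto simp: S_def)
  define X where "X = mat d (n + \<nu>) (\<lambda>(t,j). if j < n then 0 else S $$ (j - n, t))"
  have X: "X \<in> carrier_mat d (n + \<nu>)" by (simp add: X_def)
  have rowX: "row X t = 0\<^sub>v n @\<^sub>v unit_vec \<nu> (r t)" if "t < d" for t
    using that rI(3)[OF that] by (intro eq_vecI) (auto simp: X_def S_def unit_vec_def)
  \<comment> \<open>\<open>G' * X\<close> sits in the upper right block and is permitted because
    \<open>r t \<in> I'\<close>; \<open>transpose_mat X * H'\<close> sits in the lower left block
    and is permitted because \<open>r t \<in> I\<close>.\<close>
  define G' where "G' = mat (n + \<nu>) d (\<lambda>(i,t). if i < n then G $$ (i,t) else 0)"
  define H' where "H' = mat d (n + \<nu>) (\<lambda>(t,j). if j < n then H $$ (t,j) else 0)"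
  have "G' * X \<in> ?U"
    using rowX rI by (intro updates_mult_right[of _ _ d])
      (auto simp: G'_def X rows_def ext_vecs_def X[THEN carrier_matD(1)])
  moreover have "transpose_mat X * H' \<in> ?U"
    using rowX rI by (intro updates_mult_left[of _ _ d])
      (auto simp: H'_def X rows_def ext_vecs_def X[THEN carrier_matD(1)])
  ultimately have low: "G' * X + transpose_mat X * H' \<in> ?U" by (intro updates_add)
  \<comment> \<open>The shift \<open>- 1 - a\<close> turns the lower right block into minus the
    identity, whatever \<open>a\<close> is.\<close>
  define D where "D = diag_ext (0\<^sub>m n n) \<nu> (- 1 - a)"
  define Y' where "Y' = diag_ext Y \<nu> 0 + (D + (G' * X + transpose_mat X * H'))"
  have Y': "Y' \<in> ?U"
    unfolding Y'_def D_def
    by (intro updates_add updates_diag_ext[OF Y] updates_scalar_block[OF cover] low)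
  note Yc = updates_carrier[OF Y]
  have GX: "G' * X = four_block_mat (0\<^sub>m n n) (G * transpose_mat S) (0\<^sub>m \<nu> n) (0\<^sub>m \<nu> \<nu>)"
    using G S by (intro eq_matI) (auto simp: scalar_prod_def G'_def X_def)
  have XH: "transpose_mat X * H' = four_block_mat (0\<^sub>m n n) (0\<^sub>m n \<nu>) (S * H) (0\<^sub>m \<nu> \<nu>)"
    using H S by (intro eq_matI) (auto simp: scalar_prod_def H'_def X_def)
  have blocks: "diag_ext N \<nu> a + Y' =
      four_block_mat (N + Y) (G * transpose_mat S) (S * H) ((- 1) \<cdot>\<^sub>m 1\<^sub>m \<nu>)"
    unfolding Y'_def D_def GX XH diag_ext_def using N Yc G H S
    by (intro eq_matI) (auto simp: diff_add_eq)
  have "v = 0\<^sub>v (n + \<nu>)" if v: "v \<in> carrier_vec (n + \<nu>)" and eq: "(diag_ext N \<nu> a + Y') *\<^sub>v v = 0\<^sub>v (n + \<nu>)" for v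
  proof -
    define x where "x = vec_first v n"
    define y where "y = vec_last v \<nu>"
    have xy: "x \<in> carrier_vec n" "y \<in> carrier_vec \<nu>" "v = x @\<^sub>v y"
      using v by (auto simp: x_def y_def)
    have zero: "0\<^sub>v (n + \<nu>) = 0\<^sub>v n @\<^sub>v (0\<^sub>v \<nu> :: 'a vec)" by (intro eq_vecI) auto
    have "((N + Y) *\<^sub>v x + (G * transpose_mat S) *\<^sub>v y) @\<^sub>v ((S * H) *\<^sub>v x + ((- 1) \<cdot>\<^sub>m 1\<^sub>m \<nu>) *\<^sub>v y)
        = 0\<^sub>v n @\<^sub>v 0\<^sub>v \<nu>"
      using eq unfolding blocks xy(3) zero
      using N Yc G H S xy by (subst (asm) four_block_mat_mult_vec[of _ n n _ \<nu> _ \<nu>]) auto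
    moreover have "(N + Y) *\<^sub>v x + (G * transpose_mat S) *\<^sub>v y \<in> carrier_vec n"
      using G S by (intro carrier_vecI) simp
    ultimately have eqs: "(N + Y) *\<^sub>v x + (G * transpose_mat S) *\<^sub>v y = 0\<^sub>v n"
      "(S * H) *\<^sub>v x + ((- 1) \<cdot>\<^sub>m 1\<^sub>m \<nu>) *\<^sub>v y = 0\<^sub>v \<nu>"
      using append_vec_eq[of _ n "0\<^sub>v n"] by auto
    have SHx: "(S * H) *\<^sub>v x \<in> carrier_vec \<nu>" using S by (intro carrier_vecI) simp
    have "((- 1) \<cdot>\<^sub>m 1\<^sub>m \<nu>) *\<^sub>v y = (- 1) \<cdot>\<^sub>v y"
      using xy(2) by (intro eq_vecI) auto
    then have zero2: "(S * H) *\<^sub>v x + (- 1) \<cdot>\<^sub>v y = 0\<^sub>v \<nu>" using eqs(2) by simp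
    \<comment> \<open>The lower block row determines \<open>y\<close>; by \<open>SS\<close>,
      substituting it into the upper one leaves \<open>N + Y + G * H\<close> acting on
      \<open>x\<close>.\<close>
    have y: "y = (S * H) *\<^sub>v x"
    proof (rule eq_vecI)
      fix i assume "i < dim_vec ((S * H) *\<^sub>v x)"
      then have i: "i < \<nu>" using S by simp
      have "((S * H) *\<^sub>v x + (- 1) \<cdot>\<^sub>v y) $ i = ((S * H) *\<^sub>v x) $ i - y $ i"
        using i xy(2) SHx by (subst index_add_vec) auto
      then show "y $ i = ((S * H) *\<^sub>v x) $ i" unfolding zero2 using i by simp
    qed (use xy(2) S in simp)
    have "(G * transpose_mat S) *\<^sub>v y = (G * transpose_mat S * (S * H)) *\<^sub>v x"
      unfolding y using G H S xy(1) by (subst assoc_mult_mat_vec[of _ n \<nu> _ n]) auto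
    also have "G * transpose_mat S * (S * H) = G * ((transpose_mat S * S) * H)"
      using G H S by (simp add: mat_mult_assoc_dim)
    also have "\<dots> = G * H" unfolding SS using H by simp
    finally have "(N + Y) *\<^sub>v x + (G * H) *\<^sub>v x = 0\<^sub>v n" using eqs(1) by simp
    moreover have "(N + Y + G * H) *\<^sub>v x = (N + Y) *\<^sub>v x + (G * H) *\<^sub>v x"
      by (rule add_mult_distrib_mat_vec[of _ n n]) (use N Yc G H xy in auto)
    ultimately have "(N + Y + G * H) *\<^sub>v x = 0\<^sub>v n" by simp
    then have "x = 0\<^sub>v n"
      using nz det_nonzero_iff_kernel[of "N + Y + G * H" n] N Yc G H xy by simp
    moreover have "(S * H) *\<^sub>v 0\<^sub>v n = 0\<^sub>v \<nu>"
      using S H by (intro mult_mat_zero_vec) auto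
    ultimately show ?thesis using y xy(3) zero by simp
  qed
  moreover have "diag_ext N \<nu> a + Y' \<in> carrier_mat (n + \<nu>) (n + \<nu>)"
    using N updates_carrier[OF Y'] by simp
  ultimately show ?thesis using Y' det_nonzero_iff_kernel by blast
qed

text \<open>The factorization of \<open>N\<close> extends to
  \<open>diag(U1, S1) * diag(V1, S2)\<close> through dimension \<open>r + \<nu>\<close>, still below
  \<open>n + \<nu>\<close>. Disjointness of \<open>I\<close> and \<open>I'\<close> provides
  \<open>S1\<close> and \<open>S2\<close> fixing the relevant unit vectors and keeps the two
  families of preimages orthogonal, so \<open>updates_singular\<close> applies.\<close>

lemma ext_singular:
  fixes N :: "'a::field mat"
  assumes U1: "U1 \<in> carrier_mat n r" and V1: "V1 \<in> carrier_mat r n" and N: "N = U1 * V1" and r: "r < n"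
    and V: "V \<subseteq> carrier_vec r" and U: "U \<subseteq> carrier_vec r"
    and Bs: "Bs \<subseteq> (\<lambda>v. U1 *\<^sub>v v) ` V" and Cs: "Cs \<subseteq> (\<lambda>u. transpose_mat V1 *\<^sub>v u) ` U"
    and orth: "\<And>u v. u \<in> U \<Longrightarrow> v \<in> V \<Longrightarrow> u \<bullet> v = 0"
    and I: "I \<subseteq> {..<\<nu>}" and I': "I' \<subseteq> {..<\<nu>}" and disj: "I \<inter> I' = {}"
    and Y: "Y \<in> updates (n + \<nu>) (ext_vecs n \<nu> Bs I) (ext_vecs n \<nu> Cs I')"
  shows "det (diag_ext N \<nu> a + Y) = 0"
proof -
  \<comment> \<open>The scalar \<open>a\<close> goes into \<open>S2\<close> on \<open>I\<close> and
    into \<open>S1\<close> elsewhere. So \<open>S1\<close> fixes the unit vectors of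
    \<open>I\<close>, the transposed \<open>S2\<close> those of \<open>I'\<close>, and nothing is
    divided by \<open>a\<close>, which may be zero.\<close>
  define S1 where "S1 = mat \<nu> \<nu> (\<lambda>(i,j). if i = j then if i \<in> I then 1 else a else 0)"
  define S2 where "S2 = mat \<nu> \<nu> (\<lambda>(i,j). if i = j then if i \<in> I then a else 1 else 0)"
  have S: "S1 \<in> carrier_mat \<nu> \<nu>" "S2 \<in> carrier_mat \<nu> \<nu>" by (auto simp: S1_def S2_def)
  have S12: "S1 * S2 = a \<cdot>\<^sub>m 1\<^sub>m \<nu>"
  proof (rule eq_matI)
    fix i j assume "i < dim_row (a \<cdot>\<^sub>m 1\<^sub>m \<nu>)" "j < dim_col (a \<cdot>\<^sub>m 1\<^sub>m \<nu>)"
    then have ij: "i < \<nu>" "j < \<nu>" by auto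
    have "(S1 * S2) $$ (i,j) = (\<Sum>k\<in>{0..<\<nu>}. S1 $$ (i,k) * S2 $$ (k,j))"
      using ij S by (simp add: scalar_prod_def)
    also have "\<dots> = (\<Sum>k\<in>{0..<\<nu>}. if k = i then (if i = j then a else 0) else 0)"
      using ij by (intro sum.cong refl) (auto simp: S1_def S2_def)
    finally show "(S1 * S2) $$ (i,j) = (a \<cdot>\<^sub>m 1\<^sub>m \<nu>) $$ (i,j)" using ij by simp
  qed (use S in auto)
  have S1e: "S1 *\<^sub>v unit_vec \<nu> i = unit_vec \<nu> i" if "i \<in> I" for i
    using that I S by (subst mult_mat_unit_vec[of _ \<nu>]) (auto simp: S1_def unit_vec_def intro!: eq_vecI)
  have S2e: "transpose_mat S2 *\<^sub>v unit_vec \<nu> i = unit_vec \<nu> i" if "i \<in> I'" for i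
  proof -
    have "i < \<nu>" "i \<notin> I" using that I' disj by auto
    then show ?thesis
      using S by (subst mult_mat_unit_vec[of _ \<nu>]) (auto simp: S2_def unit_vec_def intro!: eq_vecI)
  qed
  define U1' where "U1' = four_block_mat U1 (0\<^sub>m n \<nu>) (0\<^sub>m \<nu> r) S1"
  define V1' where "V1' = four_block_mat V1 (0\<^sub>m r \<nu>) (0\<^sub>m \<nu> n) S2"
  have V1't: "transpose_mat V1' = four_block_mat (transpose_mat V1) (0\<^sub>m n \<nu>) (0\<^sub>m \<nu> r) (transpose_mat S2)"
    unfolding V1'_def using V1 S by (subst transpose_four_block_mat[of _ r n _ \<nu> _ \<nu>]) auto
  have app: "four_block_mat M (0\<^sub>m n \<nu>) (0\<^sub>m \<nu> r) S *\<^sub>v (x @\<^sub>v y) = (M *\<^sub>v x) @\<^sub>v (S *\<^sub>v y)"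
    if "M \<in> carrier_mat n r" "S \<in> carrier_mat \<nu> \<nu>" "x \<in> carrier_vec r" "y \<in> carrier_vec \<nu>"
    for M S :: "'a mat" and x y
  proof -
    have "0\<^sub>m n \<nu> *\<^sub>v y = 0\<^sub>v n" "0\<^sub>m \<nu> r *\<^sub>v x = 0\<^sub>v \<nu>" using that by (auto intro!: eq_vecI)
    then show ?thesis using that by (subst four_block_mat_mult_vec[of _ n r _ \<nu> _ \<nu>]) auto
  qed
  \<comment> \<open>Stated for arbitrary blocks because it serves both \<open>U1'\<close> and the
    transpose of \<open>V1'\<close>.\<close>
  have ext_image: "ext_vecs n \<nu> W J \<subseteq>
      (\<lambda>v. four_block_mat M (0\<^sub>m n \<nu>) (0\<^sub>m \<nu> r) S *\<^sub>v v) ` ext_vecs r \<nu> W' J"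
    if M: "M \<in> carrier_mat n r" "S \<in> carrier_mat \<nu> \<nu>" and W': "W' \<subseteq> carrier_vec r"
      and W: "W \<subseteq> (\<lambda>v. M *\<^sub>v v) ` W'" and J: "\<And>i. i \<in> J \<Longrightarrow> S *\<^sub>v unit_vec \<nu> i = unit_vec \<nu> i"
    for M S :: "'a mat" and W W' J
  proof
    fix z assume "z \<in> ext_vecs n \<nu> W J"
    then consider w where "w \<in> W" "z = w @\<^sub>v 0\<^sub>v \<nu>" | i where "i \<in> J" "z = 0\<^sub>v n @\<^sub>v unit_vec \<nu> i"
      by (auto simp: ext_vecs_def)
    then show "z \<in> (\<lambda>v. four_block_mat M (0\<^sub>m n \<nu>) (0\<^sub>m \<nu> r) S *\<^sub>v v) ` ext_vecs r \<nu> W' J"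
    proof cases
      case 1
      then obtain v where v: "v \<in> W'" "w = M *\<^sub>v v" using W by auto
      have "z = four_block_mat M (0\<^sub>m n \<nu>) (0\<^sub>m \<nu> r) S *\<^sub>v (v @\<^sub>v 0\<^sub>v \<nu>)"
        using 1 v M W' mult_mat_zero_vec[OF M(2)] by (subst app) auto
      then show ?thesis using v by (auto simp: ext_vecs_def)
    next
      case 2
      have "z = four_block_mat M (0\<^sub>m n \<nu>) (0\<^sub>m \<nu> r) S *\<^sub>v (0\<^sub>v r @\<^sub>v unit_vec \<nu> i)"
        using 2 M mult_mat_zero_vec[OF M(1)] J by (subst app) auto
      then show ?thesis using 2 by (auto simp: ext_vecs_def)
    qed
  qed
  have ext_carrier: "ext_vecs r \<nu> W J \<subseteq> carrier_vec (r + \<nu>)" if "W \<subseteq> carrier_vec r" for W :: "'a vec set" and J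
    using that by (auto simp: ext_vecs_def)
  show ?thesis
  proof (rule updates_singular[where ?U1.0 = U1' and ?V1.0 = V1' and r = "r + \<nu>"
        and V = "ext_vecs r \<nu> V I" and U = "ext_vecs r \<nu> U I'", OF _ _ _ _ _ _ _ _ _ Y])
    show "diag_ext N \<nu> a = U1' * V1'"
      unfolding U1'_def V1'_def using U1 V1 S N S12
      by (subst mult_four_block_mat[of _ n r _ \<nu> _ \<nu> _ _ n _ \<nu>])
        (auto simp: diag_ext_def intro!: cong_four_block_mat)
    show "U1' \<in> carrier_mat (n + \<nu>) (r + \<nu>)" "V1' \<in> carrier_mat (r + \<nu>) (n + \<nu>)"
      unfolding U1'_def V1'_def using U1 V1 S by auto
    show "r + \<nu> < n + \<nu>" using r by simp
    show "ext_vecs r \<nu> V I \<subseteq> carrier_vec (r + \<nu>)" "ext_vecs r \<nu> U I' \<subseteq> carrier_vec (r + \<nu>)"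
      using ext_carrier U V by auto
    show "ext_vecs n \<nu> Bs I \<subseteq> (\<lambda>v. U1' *\<^sub>v v) ` ext_vecs r \<nu> V I"
      unfolding U1'_def using U1 S V Bs S1e by (intro ext_image) auto
    show "ext_vecs n \<nu> Cs I' \<subseteq> (\<lambda>u. transpose_mat V1' *\<^sub>v u) ` ext_vecs r \<nu> U I'"
      unfolding V1't using V1 S U Cs S2e by (intro ext_image) auto
    fix u v assume "u \<in> ext_vecs r \<nu> U I'" "v \<in> ext_vecs r \<nu> V I"
    then show "u \<bullet> v = 0"
    \<comment> \<open>The mixed pairs vanish by zero padding, the old pairs by \<open>orth\<close>,
      and the pairs of unit vectors by disjointness of the index sets.\<close>
    proof (auto simp: ext_vecs_def, goal_cases)
      case (1 u v)
      then show ?case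
        using U V orth by (subst scalar_prod_append[of _ r _ \<nu>]) auto
    next
      case (2 u i)
      then show ?case using U by (subst scalar_prod_append[of _ r _ \<nu>]) auto
    next
      case (3 i v)
      then show ?case using V by (subst scalar_prod_append[of _ r _ \<nu>]) auto
    next
      case (4 i j)
      then have "i < \<nu>" "j < \<nu>" "i \<noteq> j" using I I' disj by auto
      then show ?case
        by (subst scalar_prod_append[of _ r _ \<nu>]) (auto simp: scalar_prod_left_unit[of _ \<nu>])
    qed
  qed
qed

section \<open>Block concatenation and the extended system\<close>

lemma carrier_hcat:
  "X \<in> carrier_mat r k \<Longrightarrow> Y \<in> carrier_mat r l \<Longrightarrow> hcat X Y \<in> carrier_mat r (k + l)"
  by (auto simp: hcat_def)

lemma atLeastLessThan_add_split: "{0..<k + l} = {0..<k} \<union> (+) k ` {0..<l}" for k l :: nat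
  by (auto simp: image_add_atLeastLessThan)

lemma set_cols_hcat:
  assumes "X \<in> carrier_mat r k" "Y \<in> carrier_mat r l"
  shows "set (cols (hcat X Y)) = set (cols X) \<union> set (cols Y)"
proof -
  have l: "col (hcat X Y) j = col X j" if "j < k" for j
    using assms that by (intro eq_vecI) (auto simp: hcat_def)
  have r: "col (hcat X Y) (k + j) = col Y j" if "j < l" for j
    using assms that by (intro eq_vecI) (auto simp: hcat_def)
  have "set (cols (hcat X Y)) = col (hcat X Y) ` {0..<k + l}"
    using carrier_hcat[OF assms] by (simp add: cols_def)
  also note atLeastLessThan_add_split
  also have "col (hcat X Y) ` ({0..<k} \<union> (+) k ` {0..<l}) = col X ` {0..<k} \<union> col Y ` {0..<l}"
    unfolding image_Un image_image using l r by simp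
  finally show ?thesis using assms by (simp add: cols_def)
qed

text \<open>Since \<open>updates\<close> sees only sets of columns and rows, this is where the order
  imposed by \<open>sorted_list_of_set\<close> drops out.\<close>

lemma hcat_set_properties:
  assumes "finite s" and "\<And>i. i \<in> s \<Longrightarrow> dim_row (M i) = r"
  shows "dim_row (hcat_set r M s) = r \<and> set (cols (hcat_set r M s)) = (\<Union>i\<in>s. set (cols (M i)))"
proof -
  have "foldr (\<lambda>i. hcat (M i)) xs (0\<^sub>m r 0) \<in> carrier_mat r (\<Sum>i\<leftarrow>xs. dim_col (M i))
      \<and> set (cols (foldr (\<lambda>i. hcat (M i)) xs (0\<^sub>m r 0))) = (\<Union>i\<in>set xs. set (cols (M i)))"
    if "set xs \<subseteq> s" for xs
    using that
  proof (induction xs)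
    case Nil
    then show ?case by (simp add: cols_def)
  next
    case (Cons i xs)
    let ?X = "foldr (\<lambda>i. hcat (M i)) xs (0\<^sub>m r 0)"
    have Mi: "M i \<in> carrier_mat r (dim_col (M i))" using Cons.prems assms(2) by auto
    have X: "?X \<in> carrier_mat r (\<Sum>i\<leftarrow>xs. dim_col (M i))"
      "set (cols ?X) = (\<Union>i\<in>set xs. set (cols (M i)))" using Cons by auto
    show ?case using carrier_hcat[OF Mi X(1)] set_cols_hcat[OF Mi X(1)] X(2) by simp
  qed
  from this[of "sorted_list_of_set s"] show ?thesis
    using assms(1) unfolding hcat_set_def by auto
qed

lemma vcat_set_transpose:
  assumes "finite s" and "\<And>i. i \<in> s \<Longrightarrow> dim_col (M i) = c"
  shows "vcat_set c M s = transpose_mat (hcat_set c (\<lambda>i. transpose_mat (M i)) s)"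
proof -
  have "foldr (\<lambda>i. vcat (M i)) xs (0\<^sub>m 0 c) =
      transpose_mat (foldr (\<lambda>i. hcat (transpose_mat (M i))) xs (0\<^sub>m c 0))
      \<and> dim_row (foldr (\<lambda>i. hcat (transpose_mat (M i))) xs (0\<^sub>m c 0)) = c" if "set xs \<subseteq> s" for xs
    using that
  proof (induction xs)
    case Nil
    then show ?case by auto
  next
    case (Cons i xs)
    then have "dim_col (M i) = c" using assms(2) by auto
    then show ?case using Cons by (auto simp: hcat_def vcat_def intro!: eq_matI)
  qed
  from this[of "sorted_list_of_set s"] show ?thesis
    using assms(1) unfolding hcat_set_def vcat_set_def by auto
qed

lemma vcat_set_properties:
  assumes "finite s" and "\<And>i. i \<in> s \<Longrightarrow> dim_col (M i) = c"
  shows "dim_col (vcat_set c M s) = c \<and> set (rows (vcat_set c M s)) = (\<Union>i\<in>s. set (rows (M i)))"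
proof -
  have "vcat_set c M s = transpose_mat (hcat_set c (\<lambda>i. transpose_mat (M i)) s)"
    by (rule vcat_set_transpose[OF assms])
  then show ?thesis
    using hcat_set_properties[OF assms(1), of "\<lambda>i. transpose_mat (M i)" c] assms(2)
    by (simp add: rows_transpose cols_transpose)
qed

section \<open>Columns and rows of the extended input and output matrices\<close>

lemma set_cols_cmat: "set (cols (cmat M)) = map_vec complex_of_real ` set (cols M)"
  by (auto simp: cmat_def cols_def image_image intro!: image_eqI)

lemma cmat_transpose: "cmat (transpose_mat M) = transpose_mat (cmat M)"
  by (auto simp: cmat_def intro!: eq_matI)

lemma set_cols_bdiag:
  assumes M: "M \<in> carrier_mat n k" and E: "E \<in> carrier_mat \<nu> l"
  shows "set (cols (cmat (bdiag M E))) =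
    (\<lambda>v. v @\<^sub>v 0\<^sub>v \<nu>) ` set (cols (cmat M)) \<union> (\<lambda>v. 0\<^sub>v n @\<^sub>v v) ` set (cols (cmat E))"
proof -
  let ?X = "cmat (bdiag M E)"
  have X: "?X \<in> carrier_mat (n + \<nu>) (k + l)" using M E by (auto simp: bdiag_def)
  have l: "col ?X j = col (cmat M) j @\<^sub>v 0\<^sub>v \<nu>" if "j < k" for j
    using M E that by (intro eq_vecI) (auto simp: bdiag_def cmat_def)
  have r: "col ?X (k + j) = 0\<^sub>v n @\<^sub>v col (cmat E) j" if "j < l" for j
    using M E that by (intro eq_vecI) (auto simp: bdiag_def cmat_def)
  have "set (cols ?X) = col ?X ` {0..<k + l}"
    using X by (simp add: cols_def del: dim_cmat)
  also note atLeastLessThan_add_split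
  also have "col ?X ` ({0..<k} \<union> (+) k ` {0..<l}) = (\<lambda>v. v @\<^sub>v 0\<^sub>v \<nu>) ` col (cmat M) ` {0..<k}
      \<union> (\<lambda>v. 0\<^sub>v n @\<^sub>v v) ` col (cmat E) ` {0..<l}"
    unfolding image_Un image_image using l r by simp
  finally show ?thesis using M E by (simp add: cols_def)
qed

text \<open>Positions of the states of channel \<open>i\<close> among all extra states; empty when
  \<open>nn i = 0\<close>.\<close>

definition block_indices :: "(nat \<Rightarrow> nat) \<Rightarrow> nat \<Rightarrow> nat set" where
  "block_indices nn i = {(\<Sum>k<i. nn k)..<(\<Sum>k<Suc i. nn k)}"

lemma sum_lessThan_mono: "i \<le> j \<Longrightarrow> (\<Sum>k<i. nn k) \<le> (\<Sum>k<j. nn k)" for nn :: "nat \<Rightarrow> nat"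
  by (intro sum_mono2) auto

lemma block_indices_disjoint:
  assumes "i \<noteq> j"
  shows "block_indices nn i \<inter> block_indices nn j = {}"
proof -
  have "block_indices nn i \<inter> block_indices nn j = {}" if "i < j" for i j
    using sum_lessThan_mono[of "Suc i" j nn] that by (auto simp: block_indices_def)
  then show ?thesis using assms by (metis inf_commute nat_neq_iff)
qed

lemma block_indices_cover: "(\<Union>i<m. block_indices nn i) = {..<(\<Sum>k<m. nn k)}"
proof (induction m)
  case (Suc m)
  have "{..<(\<Sum>k<m. nn k)} \<union> block_indices nn m = {..<(\<Sum>k<Suc m. nn k)}"
    unfolding block_indices_def by (auto simp del: sum.lessThan_Suc) (auto)
  then show ?case using Suc by (simp add: lessThan_Suc Un_commute)
qed simp

lemma set_cols_Emat:
  assumes i: "i < m"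
  shows "set (cols (cmat (Emat m nn i))) = unit_vec (\<Sum>k<m. nn k) ` block_indices nn i"
proof -
  let ?\<nu> = "\<Sum>k<m. nn k" and ?o = "\<Sum>k<i. nn k"
  have le: "?o + nn i \<le> ?\<nu>" using sum_lessThan_mono[of "Suc i" m nn] i by simp
  have "col (cmat (Emat m nn i)) c = unit_vec ?\<nu> (?o + c)" if "c < nn i" for c
    using that le by (intro eq_vecI) (auto simp: Emat_def cmat_def unit_vec_def)
  moreover have "dim_col (Emat m nn i) = nn i" by (simp add: Emat_def)
  ultimately have "set (cols (cmat (Emat m nn i))) = (\<lambda>c. unit_vec ?\<nu> (?o + c)) ` {0..<nn i}"
    by (simp add: cols_def)
  also have "\<dots> = unit_vec ?\<nu> ` (+) ?o ` {0..<nn i}" by (simp only: image_image)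
  also have "(+) ?o ` {0..<nn i} = block_indices nn i"
    by (simp add: block_indices_def image_add_atLeastLessThan add.commute)
  finally show ?thesis .
qed

lemma input_cols_Bbar:
  assumes B: "\<And>i. i < m \<Longrightarrow> B i \<in> carrier_mat n (p i)" and s: "s \<subseteq> {..<m}"
  shows "input_cols (Bbar m nn B) s =
    ext_vecs n (\<Sum>k<m. nn k) (input_cols B s) (\<Union>i\<in>s. block_indices nn i)"
proof -
  let ?\<nu> = "\<Sum>k<m. nn k"
  have "set (cols (cmat (Bbar m nn B i))) = (\<lambda>v. v @\<^sub>v 0\<^sub>v ?\<nu>) ` set (cols (cmat (B i)))
      \<union> (\<lambda>r. 0\<^sub>v n @\<^sub>v unit_vec ?\<nu> r) ` block_indices nn i" if "i \<in> s" for i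
  proof -
    have "i < m" using s that by auto
    moreover have "Emat m nn i \<in> carrier_mat ?\<nu> (nn i)" by (simp add: Emat_def)
    ultimately show ?thesis
      using set_cols_bdiag[OF B, of i "Emat m nn i" ?\<nu> "nn i"] set_cols_Emat[of i m nn]
      by (simp add: Bbar_def image_image)
  qed
  then show ?thesis by (auto simp: input_cols_def ext_vecs_def)
qed

text \<open>A channel measures the extra states of all its neighbors but drives only its own, which
  is why \<open>Nbset\<close> appears here and not in \<open>input_cols_Bbar\<close>. Transposition
  reduces the rows to the columns of a block diagonal matrix.\<close>

lemma output_rows_Cbar:
  assumes C: "\<And>i. i < m \<Longrightarrow> C i \<in> carrier_mat (q i) n" and s: "s \<subseteq> {..<m}"
    and Nb: "\<And>i. i < m \<Longrightarrow> Nb i \<subseteq> {..<m}"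
  shows "output_rows (Cbar m nn Nb C) s =
    ext_vecs n (\<Sum>k<m. nn k) (output_rows C s) (\<Union>i\<in>Nbset Nb s. block_indices nn i)"
proof -
  let ?\<nu> = "\<Sum>k<m. nn k"
  have "set (rows (cmat (Cbar m nn Nb C i))) = (\<lambda>v. v @\<^sub>v 0\<^sub>v ?\<nu>) ` set (rows (cmat (C i)))
      \<union> (\<lambda>r. 0\<^sub>v n @\<^sub>v unit_vec ?\<nu> r) ` (\<Union>j\<in>Nb i. block_indices nn j)" if "i \<in> s" for i
  proof -
    have i: "i < m" "Nb i \<subseteq> {..<m}" using s that Nb by auto
    let ?E = "hcat_set ?\<nu> (Emat m nn) (Nb i)"
    have E: "dim_row ?E = ?\<nu>" "set (cols ?E) = (\<Union>j\<in>Nb i. set (cols (Emat m nn j)))"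
      using hcat_set_properties[of "Nb i" "Emat m nn" ?\<nu>] finite_subset[OF i(2)]
      by (auto simp: Emat_def)
    have "Cbar m nn Nb C i = transpose_mat (bdiag (transpose_mat (C i)) ?E)"
      using C[OF i(1)] unfolding Cbar_def bdiag_def
      by (subst transpose_four_block_mat[of _ n "q i" _ "dim_col ?E" _ ?\<nu>]) (auto simp: E)
    then have "rows (cmat (Cbar m nn Nb C i)) = cols (cmat (bdiag (transpose_mat (C i)) ?E))"
      by (simp add: cmat_transpose rows_transpose)
    moreover have "set (cols (cmat ?E)) = unit_vec ?\<nu> ` (\<Union>j\<in>Nb i. block_indices nn j)"
    proof -
      have "set (cols (cmat ?E)) = (\<Union>j\<in>Nb i. set (cols (cmat (Emat m nn j))))"
        unfolding set_cols_cmat E(2) by auto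
      also have "\<dots> = (\<Union>j\<in>Nb i. unit_vec ?\<nu> ` block_indices nn j)"
        using i(2) set_cols_Emat by (intro SUP_cong) auto
      finally show ?thesis by (simp add: image_UN)
    qed
    moreover have "set (cols (cmat (bdiag (transpose_mat (C i)) ?E))) =
        (\<lambda>v. v @\<^sub>v 0\<^sub>v ?\<nu>) ` set (cols (cmat (transpose_mat (C i)))) \<union>
        (\<lambda>v. 0\<^sub>v n @\<^sub>v v) ` set (cols (cmat ?E))"
      using C[OF i(1)] E(1) by (intro set_cols_bdiag[of _ n "q i" _ _ "dim_col ?E"]) auto
    ultimately show ?thesis by (simp add: cmat_transpose cols_transpose image_image)
  qed
  then have "output_rows (Cbar m nn Nb C) s = (\<Union>i\<in>s. (\<lambda>v. v @\<^sub>v 0\<^sub>v ?\<nu>) ` set (rows (cmat (C i)))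
      \<union> (\<lambda>r. 0\<^sub>v n @\<^sub>v unit_vec ?\<nu> r) ` (\<Union>j\<in>Nb i. block_indices nn j))"
    unfolding output_rows_def by (intro SUP_cong) auto
  then show ?thesis
    unfolding output_rows_def ext_vecs_def Nbset_def by (simp only:) blast
qed

text \<open>Reconciles two sign conventions: \<open>char_matrix\<close> is \<open>A - lam I\<close>,
  while \<open>pbh\<close> contains \<open>lam I - A\<close>. Corrections are closed under
  negation.\<close>

lemma ex_update_nonsingular_uminus:
  fixes N :: "'a::field mat"
  assumes N: "N \<in> carrier_mat n n"
  shows "(\<exists>Y\<in>updates n Bs Cs. det ((-1) \<cdot>\<^sub>m N + Y) \<noteq> 0) \<longleftrightarrow> (\<exists>Y\<in>updates n Bs Cs. det (N + Y) \<noteq> 0)"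
proof -
  have neg: "det ((-1) \<cdot>\<^sub>m X + (-1) \<cdot>\<^sub>m Y) \<noteq> 0"
    if "det (X + Y) \<noteq> 0" "X \<in> carrier_mat n n" "Y \<in> carrier_mat n n" for X Y :: "'a mat"
  proof -
    have "(-1) \<cdot>\<^sub>m X + (-1) \<cdot>\<^sub>m Y = (-1) \<cdot>\<^sub>m (X + Y)"
      using that by (intro eq_matI) auto
    then show ?thesis using that by (simp only: det_smult) simp
  qed
  have inv: "(-1) \<cdot>\<^sub>m ((-1) \<cdot>\<^sub>m N) = N" by (intro eq_matI) auto
  show ?thesis
  proof
    assume "\<exists>Y\<in>updates n Bs Cs. det ((-1) \<cdot>\<^sub>m N + Y) \<noteq> 0"
    then obtain Y where Y: "Y \<in> updates n Bs Cs" "det ((-1) \<cdot>\<^sub>m N + Y) \<noteq> 0" by blast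
    then have "det ((-1) \<cdot>\<^sub>m ((-1) \<cdot>\<^sub>m N) + (-1) \<cdot>\<^sub>m Y) \<noteq> 0"
      using N updates_carrier by (intro neg) auto
    then show "\<exists>Y\<in>updates n Bs Cs. det (N + Y) \<noteq> 0"
      unfolding inv using updates_smult[OF Y(1)] by blast
  next
    assume "\<exists>Y\<in>updates n Bs Cs. det (N + Y) \<noteq> 0"
    then obtain Y where Y: "Y \<in> updates n Bs Cs" "det (N + Y) \<noteq> 0" by blast
    then have "det ((-1) \<cdot>\<^sub>m N + (-1) \<cdot>\<^sub>m Y) \<noteq> 0"
      using N updates_carrier by (intro neg) auto
    then show "\<exists>Y\<in>updates n Bs Cs. det ((-1) \<cdot>\<^sub>m N + Y) \<noteq> 0"
      using updates_smult[OF Y(1)] by blast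
  qed
qed

text \<open>This is \<open>not_in_fixed_spectrum_iff\<close> for the extended system, rewritten in
  terms of the original vectors: the states of \<open>s\<close> are driven, those of the neighbors
  of its complement are measured.\<close>

lemma not_in_fixed_spectrum_ext_iff:
  fixes nn :: "nat \<Rightarrow> nat"
  assumes A: "A \<in> carrier_mat n n"
    and B: "\<And>i. i < m \<Longrightarrow> B i \<in> carrier_mat n (p i)"
    and C: "\<And>i. i < m \<Longrightarrow> C i \<in> carrier_mat (q i) n"
    and Nb: "\<And>i. i < m \<Longrightarrow> Nb i \<subseteq> {..<m}"
  defines "\<nu> \<equiv> \<Sum>k<m. nn k"
  shows "lam \<notin> fixed_spectrum m (Abar n m nn A) (Bbar m nn B) (Cbar m nn Nb C) \<longleftrightarrow>
    (\<forall>s\<subseteq>{..<m}.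
      \<exists>Y\<in>updates (n + \<nu>) (ext_vecs n \<nu> (input_cols B s) (\<Union>i\<in>s. block_indices nn i))
        (ext_vecs n \<nu> (output_rows C ({..<m} - s)) (\<Union>i\<in>Nbset Nb ({..<m} - s). block_indices nn i)).
      det (diag_ext (lam \<cdot>\<^sub>m 1\<^sub>m n - cmat A) \<nu> lam + Y) \<noteq> 0)"
proof -
  let ?N = "lam \<cdot>\<^sub>m 1\<^sub>m n - cmat A"
  let ?q = "\<lambda>i. q i + dim_col (hcat_set \<nu> (Emat m nn) (Nb i))"
  have A': "Abar n m nn A \<in> carrier_mat (n + \<nu>) (n + \<nu>)"
    using A by (auto simp: Abar_def bdiag_def \<nu>_def)
  have B': "Bbar m nn B i \<in> carrier_mat (n + \<nu>) (p i + nn i)" if "i < m" for i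
    using B[OF that] by (auto simp: Bbar_def bdiag_def Emat_def \<nu>_def)
  have C': "Cbar m nn Nb C i \<in> carrier_mat (?q i) (n + \<nu>)" if "i < m" for i
  proof -
    have "dim_row (hcat_set \<nu> (Emat m nn) (Nb i)) = \<nu>"
      using hcat_set_properties[of "Nb i" "Emat m nn" \<nu>] finite_subset[OF Nb[OF that]]
      by (simp add: Emat_def \<nu>_def)
    then show ?thesis using C[OF that] by (auto simp: Cbar_def bdiag_def \<nu>_def)
  qed
  have N: "diag_ext ?N \<nu> lam \<in> carrier_mat (n + \<nu>) (n + \<nu>)"
    using A by (auto simp: diag_ext_def)
  have "char_matrix (cmat (Abar n m nn A)) lam = (-1) \<cdot>\<^sub>m diag_ext ?N \<nu> lam"
    using A by (intro eq_matI)
      (auto simp: char_matrix_def cmat_def Abar_def bdiag_def diag_ext_def \<nu>_def)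
  moreover have "lam \<notin> fixed_spectrum m (Abar n m nn A) (Bbar m nn B) (Cbar m nn Nb C) \<longleftrightarrow>
    (\<forall>s\<subseteq>{..<m}. \<exists>Y\<in>updates (n + \<nu>) (input_cols (Bbar m nn B) s)
      (output_rows (Cbar m nn Nb C) ({..<m} - s)).
      det (char_matrix (cmat (Abar n m nn A)) lam + Y) \<noteq> 0)"
    by (rule not_in_fixed_spectrum_iff[where p = "\<lambda>i. p i + nn i" and q = ?q, OF B' C' A'])
  ultimately show ?thesis
    unfolding ex_update_nonsingular_uminus[OF N, symmetric]
    using input_cols_Bbar[of m B n p _ nn, OF B] output_rows_Cbar[of m C q n _ Nb nn, OF C _ Nb]
    by (simp add: \<nu>_def)
qed

text \<open>Ties the rank condition to matrices with the column and row sets that define the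
  corrections, so that both rank lemmas become applicable.\<close>

lemma pbh_blocks:
  assumes A: "A \<in> carrier_mat n n"
    and B: "\<And>i. i < m \<Longrightarrow> B i \<in> carrier_mat n (p i)"
    and C: "\<And>i. i < m \<Longrightarrow> C i \<in> carrier_mat (q i) n" and s: "s \<subseteq> {..<m}"
  obtains k l Bs Cs where "Bs \<in> carrier_mat n k" "Cs \<in> carrier_mat l n"
    "set (cols Bs) = input_cols B s" "set (rows Cs) = output_rows C ({..<m} - s)"
    "mrank (pbh m A B C s lam) =
      vec_space.rank (n + l) (four_block_mat (lam \<cdot>\<^sub>m 1\<^sub>m n - cmat A) Bs Cs (0\<^sub>m l k))"
proof -
  let ?Bs = "hcat_set n (\<lambda>i. cmat (B i)) s" and ?Cs = "vcat_set n (\<lambda>i. cmat (C i)) ({..<m} - s)"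
  have Bs: "dim_row ?Bs = n" "set (cols ?Bs) = input_cols B s"
    using hcat_set_properties[of s "\<lambda>i. cmat (B i)" n] finite_subset[OF s] s carrier_matD(1)[OF B]
    by (auto simp: input_cols_def)
  have Cs: "dim_col ?Cs = n" "set (rows ?Cs) = output_rows C ({..<m} - s)"
    using vcat_set_properties[of "{..<m} - s" "\<lambda>i. cmat (C i)" n] carrier_matD(2)[OF C]
    by (auto simp: output_rows_def)
  have "mrank (pbh m A B C s lam) = vec_space.rank (n + dim_row ?Cs)
      (four_block_mat (lam \<cdot>\<^sub>m 1\<^sub>m n - cmat A) ?Bs ?Cs (0\<^sub>m (dim_row ?Cs) (dim_col ?Bs)))"
    using A by (simp add: mrank_def pbh_def Let_def)
  then show thesis using Bs Cs by (intro that[of ?Bs "dim_col ?Bs" ?Cs "dim_row ?Cs"]) auto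
qed

section \<open>Emptiness of the fixed spectrum of the extended system\<close>

theorem theorem3:
  fixes n m :: nat and A :: "real mat" and B C :: "nat \<Rightarrow> real mat"
    and p q :: "nat \<Rightarrow> nat" and Nb :: "nat \<Rightarrow> nat set" and nn :: "nat \<Rightarrow> nat"
  assumes A_dim: "A \<in> carrier_mat n n"
    and B_dim: "\<forall>i<m. B i \<in> carrier_mat n (p i)"
    and C_dim: "\<forall>i<m. C i \<in> carrier_mat (q i) n"
    and Nb_sub: "\<forall>i<m. Nb i \<subseteq> {..<m}"
    and Nb_self: "\<forall>i<m. i \<in> Nb i"
    and jc: "controllable A (hcat_set n B {..<m})"
    and jo: "observable (vcat_set n C {..<m}) A"
    and wc: "weakly_connected m Nb"
    and nn_bound: "\<forall>i<m. \<forall>s\<subseteq>{..<m}. \<forall>lam\<in>spec A. n - mrank (pbh m A B C s lam) \<le> nn i"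
  shows "fixed_spectrum m (Abar n m nn A) (Bbar m nn B) (Cbar m nn Nb C) = {}
     \<longleftrightarrow> (\<forall>s\<subseteq>{..<m}. (\<exists>lam\<in>spec A. mrank (pbh m A B C s lam) < n)
            \<longrightarrow> Nbset Nb ({..<m} - s) \<inter> s \<noteq> {})"
proof -
  define \<nu> where "\<nu> = (\<Sum>k<m. nn k)"
  define I where "I s = (\<Union>i\<in>s. block_indices nn i)" for s
  define N where "N lam = lam \<cdot>\<^sub>m 1\<^sub>m n - cmat A" for lam
  \<comment> \<open>The nonsingularity criterion of the extended system for a single
    \<open>lam\<close> and \<open>s\<close>; by \<open>fixed\<close>, the fixed spectrum is empty
    iff it always holds.\<close>
  define K where "K lam s \<longleftrightarrow> (\<exists>Y\<in>updates (n + \<nu>) (ext_vecs n \<nu> (input_cols B s) (I s))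
      (ext_vecs n \<nu> (output_rows C ({..<m} - s)) (I (Nbset Nb ({..<m} - s)))).
      det (diag_ext (N lam) \<nu> lam + Y) \<noteq> 0)" for lam s
  have N: "N lam \<in> carrier_mat n n" for lam
    unfolding N_def using A_dim by (intro minus_carrier_mat) simp
  have fixed: "lam \<notin> fixed_spectrum m (Abar n m nn A) (Bbar m nn B) (Cbar m nn Nb C) \<longleftrightarrow>
      (\<forall>s\<subseteq>{..<m}. K lam s)" for lam
    unfolding K_def I_def \<nu>_def N_def
    using A_dim B_dim C_dim Nb_sub by (intro not_in_fixed_spectrum_ext_iff) auto
  have I_sub: "I s \<subseteq> {..<\<nu>}" if "s \<subseteq> {..<m}" for s
    using that block_indices_cover[of nn m] unfolding I_def \<nu>_def by blast
  have Nbset_sub: "Nbset Nb s \<subseteq> {..<m}" "s \<subseteq> Nbset Nb s" if "s \<subseteq> {..<m}" for s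
    using that Nb_sub Nb_self by (auto simp: Nbset_def)
  \<comment> \<open>Every channel is its own neighbor, so each extra state is driven by
    \<open>s\<close> or measured by the complement.\<close>
  have cover: "{..<\<nu>} \<subseteq> I s \<union> I (Nbset Nb ({..<m} - s))" for s
  proof -
    have "{..<m} \<subseteq> s \<union> Nbset Nb ({..<m} - s)" using Nbset_sub(2)[of "{..<m} - s"] by auto
    then show ?thesis using block_indices_cover[of nn m] unfolding I_def \<nu>_def by blast
  qed
  \<comment> \<open>Off the spectrum of \<open>A\<close> the matrix \<open>N lam\<close> is already
    nonsingular, so the zero correction with inner dimension \<open>0\<close> is enough.\<close>
  have regular: "K lam s" if s: "s \<subseteq> {..<m}" and lam: "lam \<notin> spec A" for lam s
  proof -
    have "N lam = (-1) \<cdot>\<^sub>m char_matrix (cmat A) lam"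
      using A_dim by (intro eq_matI) (auto simp: N_def char_matrix_def cmat_def)
    moreover have "det (char_matrix (cmat A) lam) \<noteq> 0"
      using lam A_dim eigenvalue_det[of "cmat A" n lam] by (simp add: spec_def)
    ultimately have "det (N lam) \<noteq> 0" by (simp only: det_smult) simp
    moreover have "N lam + 0\<^sub>m n n + 0\<^sub>m n 0 * 0\<^sub>m 0 n = N lam"
      using N[of lam] by (intro eq_matI) auto
    ultimately show ?thesis
      unfolding K_def using I_sub[OF s] cover[of s] N[of lam] updates.zero
      by (intro ext_nonsingular[where d = 0 and Y = "0\<^sub>m n n" and G = "0\<^sub>m n 0" and H = "0\<^sub>m 0 n"]) auto
  qed
  have coupled: "K lam s" if s: "s \<subseteq> {..<m}" and lam: "lam \<in> spec A"
    and cond: "mrank (pbh m A B C s lam) < n \<longrightarrow> Nbset Nb ({..<m} - s) \<inter> s \<noteq> {}" for lam s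
  proof -
    obtain k l Bs Cs where blocks: "Bs \<in> carrier_mat n k" "Cs \<in> carrier_mat l n"
      "set (cols Bs) = input_cols B s" "set (rows Cs) = output_rows C ({..<m} - s)"
      "mrank (pbh m A B C s lam) = vec_space.rank (n + l) (four_block_mat (N lam) Bs Cs (0\<^sub>m l k))"
      using pbh_blocks[OF A_dim _ _ s, of B p C q lam] B_dim C_dim unfolding N_def by metis
    \<comment> \<open>The rank may exceed \<open>n\<close>. Capping it makes the inner dimension
      \<open>n - ?k\<close> zero in that case, and no shared state is needed.\<close>
    let ?k = "min n (mrank (pbh m A B C s lam))"
    obtain Y G H where Y: "Y \<in> updates n (input_cols B s) (output_rows C ({..<m} - s))"
      "G \<in> carrier_mat n (n - ?k)" "H \<in> carrier_mat (n - ?k) n" "det (N lam + Y + G * H) \<noteq> 0"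
      using rank_ge_imp_update_nonsingular[OF N blocks(1,2), of ?k lam] blocks(3-5) by auto
    have "n - ?k \<le> card (I s \<inter> I (Nbset Nb ({..<m} - s)))"
    proof (cases "mrank (pbh m A B C s lam) < n")
      case True
      \<comment> \<open>The whole block of such a channel is both driven and measured, and
        \<open>nn_bound\<close> makes it large enough for the coupling.\<close>
      then obtain i where i: "i \<in> s" "i \<in> Nbset Nb ({..<m} - s)" using cond by auto
      then have "i < m" using s by auto
      then have "n - ?k \<le> nn i" using nn_bound s lam True by auto
      also have "nn i = card (block_indices nn i)" by (simp add: block_indices_def)
      also have "\<dots> \<le> card (I s \<inter> I (Nbset Nb ({..<m} - s)))"
        using i finite_subset[OF I_sub[OF s]] by (intro card_mono) (auto simp: I_def)
      finally show ?thesis .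
    qed simp
    then show ?thesis
      unfolding K_def using ext_nonsingular[OF N cover I_sub[OF s] _ Y] by blast
  qed
  \<comment> \<open>The rank deficit gives a factorization of \<open>N lam\<close> through a
    dimension below \<open>n\<close>; with no channel in the intersection, the driven and the
    measured blocks are disjoint, as \<open>ext_singular\<close> requires.\<close>
  have uncoupled: "\<not> K lam s" if s: "s \<subseteq> {..<m}" and rank: "mrank (pbh m A B C s lam) < n"
    and disj: "Nbset Nb ({..<m} - s) \<inter> s = {}" for lam s
  proof -
    obtain k l Bs Cs where blocks: "Bs \<in> carrier_mat n k" "Cs \<in> carrier_mat l n"
      "set (cols Bs) = input_cols B s" "set (rows Cs) = output_rows C ({..<m} - s)"
      "mrank (pbh m A B C s lam) = vec_space.rank (n + l) (four_block_mat (N lam) Bs Cs (0\<^sub>m l k))"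
      using pbh_blocks[OF A_dim _ _ s, of B p C q lam] B_dim C_dim unfolding N_def by metis
    have "I s \<inter> I (Nbset Nb ({..<m} - s)) = {}"
    proof -
      have "block_indices nn i \<inter> block_indices nn j = {}"
        if "i \<in> s" "j \<in> Nbset Nb ({..<m} - s)" for i j
        using that disj by (intro block_indices_disjoint) auto
      then show ?thesis unfolding I_def by blast
    qed
    then have "det (diag_ext (N lam) \<nu> lam + Y) = 0"
      if "Y \<in> updates (n + \<nu>) (ext_vecs n \<nu> (input_cols B s) (I s))
        (ext_vecs n \<nu> (output_rows C ({..<m} - s)) (I (Nbset Nb ({..<m} - s))))" for Y
      using block_rank_factorization[OF N blocks(1,2), of lam]
        ext_singular[OF _ _ _ rank[unfolded blocks(5)] _ _ _ _ _ I_sub[OF s] I_sub _ that]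
        Nbset_sub(1)[of "{..<m} - s"] blocks(3,4)
      by (metis Diff_subset)
    then show ?thesis by (auto simp: K_def)
  qed
  show ?thesis
  proof
    assume "fixed_spectrum m (Abar n m nn A) (Bbar m nn B) (Cbar m nn Nb C) = {}"
    then show "\<forall>s\<subseteq>{..<m}. (\<exists>lam\<in>spec A. mrank (pbh m A B C s lam) < n)
        \<longrightarrow> Nbset Nb ({..<m} - s) \<inter> s \<noteq> {}"
      using fixed uncoupled by blast
  next
    assume "\<forall>s\<subseteq>{..<m}. (\<exists>lam\<in>spec A. mrank (pbh m A B C s lam) < n)
        \<longrightarrow> Nbset Nb ({..<m} - s) \<inter> s \<noteq> {}"
    then have "K lam s" if "s \<subseteq> {..<m}" for lam s
      using that regular coupled by (cases "lam \<in> spec A") blast+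
    then show "fixed_spectrum m (Abar n m nn A) (Bbar m nn B) (Cbar m nn Nb C) = {}"
      using fixed by blast
  qed
qed

end
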